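(* Let $A_0,A_1\in M_2(\mathbb{R})$ be an admissible pair (as defined in the context). Let $\alpha>0$ be irrational, and define $B_0,B_1,B_2,B_3\in M_4(\mathbb{R})$ by \[B_0:=A_0\otimes I+\alpha\, I\otimes A_0,\quad B_1:=A_1\otimes I+\alpha\, I\otimes A_0,\] \[B_2:=A_0\otimes I+\alpha\, I\otimes A_1,\quad B_3:=A_1\otimes I+\alpha\, I\otimes A_1,\] where $I$ is the $2\times 2$ identity matrix. Let $\mathsf{B}$ denote the convex hull of $\{B_0,B_1,B_2,B_3\}$. Then: (i) There exists a constant $K>0$ such that for every Lebesgue measurable $B\colon[0,\infty)\to\mathsf{B}$ and every $w\in\mathbb{R}^4$, the solution to $\dot{x}(t)=B(t)x(t)$, $x(0)=w$ satisfies $\|x(t)\|\le K\|x(0)\|$ for all $t\ge 0$. (ii) If $B\colon[0,\infty)\to\mathsf{B}$ is Lebesgue measurable and periodic, then every solution to $\dot{x}(t)=B(t)x(t)$ converges exponentially to the origin as $t\to\infty$. (iii) There exist a piecewise constant function $B\colon[0,\infty)\to\{B_0,B_1,B_2,B_3\}$ and a vector $w\in\mathbb{R}^4$ such that the solution to $\dot{x}(t)=B(t)x(t)$, $x(0)=w$ does not accumulate at the origin.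
   Context: $M_d(\mathbb{R})$ is the set of real $d\times d$ matrices, $\otimes$ is the Kronecker product of matrices, and $\|\cdot\|$ is the Euclidean norm. A matrix is Hurwitz if all its eigenvalues have negative real part. Solutions of $\dot{x}(t)=B(t)x(t)$ with measurable $B$ are in the Carathéodory sense: $x$ is absolutely continuous on compact intervals and satisfies the equation for a.e. $t\ge0$; it is unique given $x(0)$. Definition (admissible pair). A pair $A_0,A_1\in M_2(\mathbb{R})$ is called admissible if all of the following hold, where (E) denotes the equation $\dot{x}(t)=((1-u(t))A_0+u(t)A_1)x(t)$ on $[0,\infty)$ for $x(t)\in\mathbb{R}^2$: (a) The matrices $I,A_0,A_1$ are linearly independent, and for every $\gamma\in[0,1]$ the matrix $(1-\gamma)A_0+\gamma A_1$ is Hurwitz. (b) There exists $C>0$ such that for every Lebesgue measurable $u\colon[0,\infty)\to[0,1]$, every absolutely continuous solution $x$ of (E) satisfies $\|x(t)\|\le C\|x(0)\|$ for all $t\ge0$. (c) There are constants $T>0$ and $T_0\in(0,T)$ such that, letting $u_0\colon[0,\infty)\to[0,1]$ be the function of period $T$ equal to $0$ on $[0,T_0)$ and to $1$ on $[T_0,T)$, the following holds: for every nonzero $w\in\mathbb{R}^2$ there exists a Lebesgue measurable $u\colon[0,\infty)\to[0,1]$ such that the solution of (E) with $x(0)=w$ is periodic; this $u$ is unique up to Lebesgue measure zero, is periodic with period $T$, is piecewise constant, and satisfies $u(t)=u_0(t+t_0)$ for a.e. $t$, for some $t_0\in[0,T)$ depending only on $w$. (d) With $T$ and $u_0$ as in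 (c): if $u\colon[0,\infty)\to[0,1]$ is a periodic Lebesgue measurable function, then either every solution of (E) converges exponentially to the origin, or there exists a non-constant periodic solution of (E). In the latter case $u(t)=u_0(t+t_0)$ a.e. for some $t_0\in[0,T)$, and in particular $u$ has period $T$. The solution $x$ "does not accumulate at the origin" means that the origin is not an accumulation point of $x(t)$ as $t\to\infty$, i.e. $\liminf_{t\to\infty}\|x(t)\|>0$. *)

theory Defs
  imports "HOL-Analysis.Analysis"
begin

section \<open>Matrices\<close>

text \<open>
  Rows and columns of the Kronecker product are enumerated lexicographically: the index pairs
  (1,1), (1,2), (2,1), (2,2) become 1, 2, 3, 4.
\<close>

definition kron_fst :: "4 \<Rightarrow> 2" where
  "kron_fst i = (if i = 1 \<or> i = 2 then 1 else 2)"

definition kron_snd :: "4 \<Rightarrow> 2" where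
  "kron_snd i = (if i = 1 \<or> i = 3 then 1 else 2)"

definition kron :: "real^2^2 \<Rightarrow> real^2^2 \<Rightarrow> real^4^4" where
  "kron P Q = (\<chi> i j. P $ kron_fst i $ kron_fst j * Q $ kron_snd i $ kron_snd j)"

definition hurwitz :: "real^'n^'n \<Rightarrow> bool" where
  "hurwitz M \<longleftrightarrow>
     (\<forall>(z::complex) v. v \<noteq> 0 \<and> map_matrix complex_of_real M *v v = z *s v \<longrightarrow> Re z < 0)"

section \<open>Functions on the half-line\<close>

text \<open>
  A function on $[0,\infty)$ is a total function on the reals of which only the values at
  nonnegative arguments matter.
\<close>

definition measurable_halfline :: "(real \<Rightarrow> 'a::topological_space) \<Rightarrow> bool" where
  "measurable_halfline f \<longleftrightarrow> f \<in> borel_measurable (lebesgue_on {0..})"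

definition has_period :: "(real \<Rightarrow> 'a) \<Rightarrow> real \<Rightarrow> bool" where
  "has_period f P \<longleftrightarrow> P > 0 \<and> (\<forall>t\<ge>0. f (t + P) = f t)"

definition periodic :: "(real \<Rightarrow> 'a) \<Rightarrow> bool" where
  "periodic f \<longleftrightarrow> (\<exists>P. has_period f P)"

text \<open>
  Each bounded interval contains finitely many break points, and the function is constant
  between them; its values at the break points are arbitrary.
\<close>

definition piecewise_constant :: "(real \<Rightarrow> 'a) \<Rightarrow> bool" where
  "piecewise_constant f \<longleftrightarrow>
     (\<forall>b\<ge>0. \<exists>S. finite S \<and> (\<forall>s t. {s..t} \<subseteq> {0..b} - S \<longrightarrow> f constant_on {s..t}))"

definition ae_eq :: "(real \<Rightarrow> 'a) \<Rightarrow> (real \<Rightarrow> 'a) \<Rightarrow> bool" where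
  "ae_eq f g \<longleftrightarrow> (AE t in lebesgue. t \<ge> 0 \<longrightarrow> f t = g t)"

definition converges_exponentially_to_0 :: "(real \<Rightarrow> 'a::real_normed_vector) \<Rightarrow> bool" where
  "converges_exponentially_to_0 x \<longleftrightarrow>
     (\<exists>M>0. \<exists>c>0. \<forall>t\<ge>0. norm (x t) \<le> M * exp (- (c * t)))"

definition accumulates_at_0 :: "(real \<Rightarrow> 'a::real_normed_vector) \<Rightarrow> bool" where
  "accumulates_at_0 x \<longleftrightarrow> \<not> Liminf at_top (\<lambda>t. ereal (norm (x t))) > 0"

section \<open>Caratheodory solutions\<close>

text \<open>
  A finite family of non-overlapping compact intervals is a division of its own union.
\<close>

definition absolutely_continuous_on ::
    "real set \<Rightarrow> (real \<Rightarrow> 'a::real_normed_vector) \<Rightarrow> bool" where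
  "absolutely_continuous_on S f \<longleftrightarrow>
     (\<forall>\<epsilon>>0. \<exists>\<delta>>0. \<forall>\<D>. \<D> division_of \<Union>\<D> \<and> \<Union>\<D> \<subseteq> S \<and> (\<Sum>K\<in>\<D>. Sup K - Inf K) < \<delta> \<longrightarrow>
        (\<Sum>K\<in>\<D>. norm (f (Sup K) - f (Inf K))) < \<epsilon>)"

definition caratheodory_solution :: "(real \<Rightarrow> real^'n^'n) \<Rightarrow> (real \<Rightarrow> real^'n) \<Rightarrow> bool" where
  "caratheodory_solution B x \<longleftrightarrow>
     (\<forall>b\<ge>0. absolutely_continuous_on {0..b} x) \<and>
     (AE t in lebesgue. t \<ge> 0 \<longrightarrow> (x has_vector_derivative B t *v x t) (at t within {0..}))"

section \<open>Admissible pairs\<close>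

definition mix :: "real^'n^'n \<Rightarrow> real^'n^'n \<Rightarrow> real \<Rightarrow> real^'n^'n" where
  "mix A0 A1 \<gamma> = (1 - \<gamma>) *\<^sub>R A0 + \<gamma> *\<^sub>R A1"

definition control :: "(real \<Rightarrow> real) \<Rightarrow> bool" where
  "control u \<longleftrightarrow> measurable_halfline u \<and> (\<forall>t\<ge>0. u t \<in> {0..1})"

abbreviation switched_solution ::
    "real^'n^'n \<Rightarrow> real^'n^'n \<Rightarrow> (real \<Rightarrow> real) \<Rightarrow> (real \<Rightarrow> real^'n) \<Rightarrow> bool" where
  "switched_solution A0 A1 u x \<equiv> caratheodory_solution (\<lambda>t. mix A0 A1 (u t)) x"

text \<open>
  The \<open>T\<close>-periodic function equal to 0 on $[0,T_0)$ and to 1 on $[T_0,T)$;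
  \<^term>\<open>T * frac (t / T)\<close> is the representative of \<open>t\<close> modulo \<open>T\<close> in $[0,T)$.
\<close>

definition square_wave :: "real \<Rightarrow> real \<Rightarrow> real \<Rightarrow> real" where
  "square_wave T0 T t = (if T * frac (t / T) < T0 then 0 else 1)"

definition admissible_a :: "real^2^2 \<Rightarrow> real^2^2 \<Rightarrow> bool" where
  "admissible_a A0 A1 \<longleftrightarrow>
     distinct [mat 1, A0, A1] \<and> independent {mat 1, A0, A1} \<and>
     (\<forall>\<gamma>\<in>{0..1}. hurwitz (mix A0 A1 \<gamma>))"

definition admissible_b :: "real^2^2 \<Rightarrow> real^2^2 \<Rightarrow> bool" where
  "admissible_b A0 A1 \<longleftrightarrow>
     (\<exists>C>0. \<forall>u x. control u \<and> switched_solution A0 A1 u x \<longrightarrow>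
        (\<forall>t\<ge>0. norm (x t) \<le> C * norm (x 0)))"

text \<open>
  Changing a control on a null set does not change its solutions. Hence the control in (c) can
  only be unique up to null sets, and exact periodicity and piecewise constancy are required of
  one representative. For the same reason the period \<open>T\<close> in (d) is understood almost everywhere.
\<close>

definition admissible_c :: "real^2^2 \<Rightarrow> real^2^2 \<Rightarrow> real \<Rightarrow> real \<Rightarrow> bool" where
  "admissible_c A0 A1 T0 T \<longleftrightarrow>
     (\<forall>w. w \<noteq> 0 \<longrightarrow>
        (\<exists>u. control u \<and>
           (\<exists>x. switched_solution A0 A1 u x \<and> x 0 = w \<and> periodic x) \<and>
           (\<forall>v. control v \<and> (\<exists>x. switched_solution A0 A1 v x \<and> x 0 = w \<and> periodic x) \<longrightarrow>
              ae_eq v u) \<and>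
           has_period u T \<and>
           piecewise_constant u \<and>
           (\<exists>t0\<in>{0..<T}. ae_eq u (\<lambda>t. square_wave T0 T (t + t0)))))"

definition admissible_d :: "real^2^2 \<Rightarrow> real^2^2 \<Rightarrow> real \<Rightarrow> real \<Rightarrow> bool" where
  "admissible_d A0 A1 T0 T \<longleftrightarrow>
     (\<forall>u. control u \<and> periodic u \<longrightarrow>
        (let nonconstant_orbit =
           (\<exists>x. switched_solution A0 A1 u x \<and> periodic x \<and> \<not> x constant_on {0..})
         in ((\<forall>x. switched_solution A0 A1 u x \<longrightarrow> converges_exponentially_to_0 x) \<or>
             nonconstant_orbit) \<and>
            (nonconstant_orbit \<longrightarrow>
               (\<exists>t0\<in>{0..<T}. ae_eq u (\<lambda>t. square_wave T0 T (t + t0))) \<and>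
               ae_eq (\<lambda>t. u (t + T)) u)))"

definition admissible :: "real^2^2 \<Rightarrow> real^2^2 \<Rightarrow> bool" where
  "admissible A0 A1 \<longleftrightarrow>
     admissible_a A0 A1 \<and> admissible_b A0 A1 \<and>
     (\<exists>T0 T. 0 < T0 \<and> T0 < T \<and> admissible_c A0 A1 T0 T \<and> admissible_d A0 A1 T0 T)"

end

theory Submission
  imports Defs
begin

text \<open>
  An element of the hull is \<open>mix A0 A1 p \<otimes> I + \<alpha> I \<otimes> mix A0 A1 q\<close> with \<open>p\<close>, \<open>q\<close> in
  $[0,1]$ depending linearly on it. Hence the solutions are combinations of the products
  \<open>\<phi> t \<otimes> \<psi> (\<alpha> t)\<close>, where \<open>\<phi>\<close> and \<open>\<psi>\<close> solve the planar switched equation with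
  controls \<open>u\<close> and \<open>v\<close> given by \<open>u t = p t\<close>, \<open>v (\<alpha> t) = q t\<close>. Condition (b) bounds these
  products. If the switching law has period \<open>P\<close>, then \<open>u\<close> and \<open>v\<close> have the periods \<open>P\<close> and
  \<open>\<alpha> P\<close>; since \<open>\<alpha>\<close> is irrational, these are not both multiples of \<open>T\<close>, so by (d) one
  factor decays exponentially. For \<open>u = v = u_0\<close> both factors can be chosen periodic and nonzero.
\<close>

section \<open>Absolutely continuous functions\<close>

text \<open>Products of planar solutions account for every solution only if the planar equation can
  be solved for an arbitrary measurable control and any initial vector, and if a solution in R^4 is
  determined by its initial value. Hence the weight of the proof lies in Caratheodory theory, built
  on absolute continuity in terms of divisions. Uniqueness rests on monotonicity of functions whose
  derivative is nonpositive almost everywhere, existence on almost everywhere differentiability of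
  an indefinite integral. Reading off \<open>p\<close> and \<open>q\<close> by fixed linear
  functionals, rather than choosing convex coefficients, lets the controls inherit measurability and
  exact periods. Such functionals exist because linear independence of I, A0, A1 keeps A1 - A0 from
  being a scalar matrix. The factor \<alpha> acts as a second clock: periods P = k T and \<alpha> P
  = l T would give \<alpha> = l / k. The bound in (i) is 4 C^2: a factor C from each planar
  solution, and four basis tensors. In (iii) the lower bounds of the factors survive because the
  norm of a tensor is the product of the norms, however the two clocks are related.\<close>

lemma division_interval_endpoints:
  fixes S :: "real set"
  assumes "\<D> division_of \<Union>\<D>" "\<Union>\<D> \<subseteq> S" "K \<in> \<D>"
  shows "Inf K \<le> Sup K" "{Inf K..Sup K} = K" "Inf K \<in> S" "Sup K \<in> S"
proof -
  obtain a b where K: "K = cbox a b" "K \<noteq> {}"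
    using division_ofD(3,4)[OF assms(1,3)] by blast
  then have "a \<le> b" "K = {a..b}" by auto
  then show "Inf K \<le> Sup K" "{Inf K..Sup K} = K" by auto
  then have "Inf K \<in> K" "Sup K \<in> K" by (metis atLeastAtMost_iff order_refl)+
  then show "Inf K \<in> S" "Sup K \<in> S" using assms by auto
qed

text \<open>Both sides are summed over the same division, so an estimate of increments is enough.
  This one principle yields sums, differences, multiples, bilinear products and Lipschitz
  functions.\<close>

lemma absolutely_continuous_on_dominated:
  fixes f :: "real \<Rightarrow> 'a::real_normed_vector" and g :: "real \<Rightarrow> 'b::real_normed_vector"
    and h :: "real \<Rightarrow> 'c::real_normed_vector"
  assumes f: "absolutely_continuous_on S f" and g: "absolutely_continuous_on S g"
    and h: "\<And>a b. a \<in> S \<Longrightarrow> b \<in> S \<Longrightarrow> norm (h b - h a) \<le> M * (norm (f b - f a) + norm (g b - g a))"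
  shows "absolutely_continuous_on S h"
  unfolding absolutely_continuous_on_def
proof (intro allI impI)
  fix \<epsilon> :: real assume "\<epsilon> > 0"
  \<comment> \<open>\<open>M\<close> may be zero or negative; a positive constant is needed for the
    division in \<open>e\<close> and for the strict inequality at the end.\<close>
  define M' where "M' = \<bar>M\<bar> + 1"
  have "M' > 0" "M \<le> M'" by (auto simp: M'_def)
  define e where "e = \<epsilon> / (2 * M')"
  have "e > 0" using \<open>\<epsilon> > 0\<close> \<open>M' > 0\<close> by (simp add: e_def)
  obtain d1 where d1: "d1 > 0" "\<And>\<D>. \<D> division_of \<Union>\<D> \<and> \<Union>\<D> \<subseteq> S \<and> (\<Sum>K\<in>\<D>. Sup K - Inf K) < d1 \<Longrightarrow>
        (\<Sum>K\<in>\<D>. norm (f (Sup K) - f (Inf K))) < e"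
    using f \<open>e > 0\<close> unfolding absolutely_continuous_on_def by blast
  obtain d2 where d2: "d2 > 0" "\<And>\<D>. \<D> division_of \<Union>\<D> \<and> \<Union>\<D> \<subseteq> S \<and> (\<Sum>K\<in>\<D>. Sup K - Inf K) < d2 \<Longrightarrow>
        (\<Sum>K\<in>\<D>. norm (g (Sup K) - g (Inf K))) < e"
    using g \<open>e > 0\<close> unfolding absolutely_continuous_on_def by blast
  show "\<exists>\<delta>>0. \<forall>\<D>. \<D> division_of \<Union>\<D> \<and> \<Union>\<D> \<subseteq> S \<and> (\<Sum>K\<in>\<D>. Sup K - Inf K) < \<delta> \<longrightarrow>
        (\<Sum>K\<in>\<D>. norm (h (Sup K) - h (Inf K))) < \<epsilon>"
  proof (intro exI[of _ "min d1 d2"] conjI allI impI)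
    show "0 < min d1 d2" using d1 d2 by auto
    fix \<D> assume D: "\<D> division_of \<Union>\<D> \<and> \<Union>\<D> \<subseteq> S \<and> (\<Sum>K\<in>\<D>. Sup K - Inf K) < min d1 d2"
    have "(\<Sum>K\<in>\<D>. norm (h (Sup K) - h (Inf K)))
        \<le> (\<Sum>K\<in>\<D>. M' * (norm (f (Sup K) - f (Inf K)) + norm (g (Sup K) - g (Inf K))))"
    proof (rule sum_mono)
      fix K assume "K \<in> \<D>"
      then have "norm (h (Sup K) - h (Inf K)) \<le> M * (norm (f (Sup K) - f (Inf K)) + norm (g (Sup K) - g (Inf K)))"
        using h division_interval_endpoints D by metis
      also have "\<dots> \<le> M' * (norm (f (Sup K) - f (Inf K)) + norm (g (Sup K) - g (Inf K)))"
        using \<open>M \<le> M'\<close> by (intro mult_right_mono) auto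
      finally show "norm (h (Sup K) - h (Inf K)) \<le> \<dots>" .
    qed
    also have "\<dots> = M' * ((\<Sum>K\<in>\<D>. norm (f (Sup K) - f (Inf K))) + (\<Sum>K\<in>\<D>. norm (g (Sup K) - g (Inf K))))"
      by (simp only: sum_distrib_left sum.distrib[symmetric] distrib_left)
    also have "\<dots> < M' * (e + e)"
      using d1(2)[of \<D>] d2(2)[of \<D>] D \<open>M' > 0\<close> by (intro mult_strict_left_mono add_strict_mono) auto
    also have "\<dots> = \<epsilon>" using \<open>M' > 0\<close> by (simp add: e_def)
    finally show "(\<Sum>K\<in>\<D>. norm (h (Sup K) - h (Inf K))) < \<epsilon>" .
  qed
qed

lemma absolutely_continuous_on_subset:
  "absolutely_continuous_on S f \<Longrightarrow> S' \<subseteq> S \<Longrightarrow> absolutely_continuous_on S' f"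
  unfolding absolutely_continuous_on_def by (meson order_trans)

lemma absolutely_continuous_on_lipschitz:
  fixes h :: "real \<Rightarrow> 'a::real_normed_vector"
  assumes "\<And>a b. a \<in> S \<Longrightarrow> b \<in> S \<Longrightarrow> norm (h b - h a) \<le> M * \<bar>b - a\<bar>"
  shows "absolutely_continuous_on S h"
proof -
  have "absolutely_continuous_on S (\<lambda>t. t :: real)"
    unfolding absolutely_continuous_on_def
  proof (intro allI impI)
    fix \<epsilon> :: real assume "\<epsilon> > 0"
    have "(\<Sum>K\<in>\<D>. norm (Sup K - Inf K)) = (\<Sum>K\<in>\<D>. Sup K - Inf K)"
      if "\<D> division_of \<Union>\<D>" for \<D> :: "real set set"
      using division_interval_endpoints(1)[OF that subset_UNIV] by (intro sum.cong) auto
    then show "\<exists>\<delta>>0. \<forall>\<D>. \<D> division_of \<Union>\<D> \<and> \<Union>\<D> \<subseteq> S \<and> (\<Sum>K\<in>\<D>. Sup K - Inf K) < \<delta> \<longrightarrow>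
        (\<Sum>K\<in>\<D>. norm (Sup K - Inf K)) < \<epsilon>"
      using \<open>\<epsilon> > 0\<close> by (intro exI[of _ \<epsilon>]) auto
  qed
  then show ?thesis
    \<comment> \<open>The identity plays both dominating functions, hence the factor
      \<open>M/2\<close>.\<close>
    using absolutely_continuous_on_dominated[of S "\<lambda>t. t" "\<lambda>t. t" h "M/2"] assms by fastforce
qed

lemma absolutely_continuous_on_imp_continuous_on:
  fixes f :: "real \<Rightarrow> 'a::real_normed_vector"
  assumes "absolutely_continuous_on {a..b} f"
  shows "continuous_on {a..b} f"
  unfolding continuous_on_iff
proof (intro ballI allI impI)
  fix x e :: real assume x: "x \<in> {a..b}" and "e > 0"
  then obtain d where d: "d > 0" "\<And>\<D>. \<D> division_of \<Union>\<D> \<and> \<Union>\<D> \<subseteq> {a..b} \<and> (\<Sum>K\<in>\<D>. Sup K - Inf K) < d \<Longrightarrow>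
        (\<Sum>K\<in>\<D>. norm (f (Sup K) - f (Inf K))) < e"
    using assms unfolding absolutely_continuous_on_def by blast
  have *: "norm (f v - f u) < e" if "u \<le> v" "u \<in> {a..b}" "v \<in> {a..b}" "v - u < d" for u v
  proof -
    have "{{u..v}} division_of {u..v}"
      using that division_of_self[of u v] by (simp add: box_real)
    then show ?thesis
      using d(2)[of "{{u..v}}"] that by auto
  qed
  show "\<exists>d>0. \<forall>x'\<in>{a..b}. dist x' x < d \<longrightarrow> dist (f x') (f x) < e"
  proof (intro exI[of _ d] conjI ballI impI d(1))
    fix y assume "y \<in> {a..b}" "dist y x < d"
    then show "dist (f y) (f x) < e"
      using *[of x y] *[of y x] x by (cases "x \<le> y") (auto simp: dist_norm norm_minus_commute)
  qed
qed

text \<open>The increment splits as in the product rule, and both factors are bounded on the compact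
  interval by continuity.\<close>

lemma bounded_bilinear_absolutely_continuous_on:
  assumes h: "bounded_bilinear h"
    and f: "absolutely_continuous_on {a..b} f" and g: "absolutely_continuous_on {a..b} g"
  shows "absolutely_continuous_on {a..b} (\<lambda>t. h (f t) (g t))"
proof -
  obtain Mf where Mf: "\<And>t. t \<in> {a..b} \<Longrightarrow> norm (f t) \<le> Mf"
    using compact_imp_bounded[OF compact_continuous_image[OF absolutely_continuous_on_imp_continuous_on[OF f]]]
    unfolding bounded_iff by (metis compact_Icc image_eqI)
  obtain Mg where Mg: "\<And>t. t \<in> {a..b} \<Longrightarrow> norm (g t) \<le> Mg"
    using compact_imp_bounded[OF compact_continuous_image[OF absolutely_continuous_on_imp_continuous_on[OF g]]]
    unfolding bounded_iff by (metis compact_Icc image_eqI)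
  obtain K where K: "K \<ge> 0" "\<And>a b. norm (h a b) \<le> norm a * norm b * K"
    using bounded_bilinear.nonneg_bounded[OF h] by blast
  show ?thesis
  proof (rule absolutely_continuous_on_dominated[OF f g])
    fix s t assume st: "s \<in> {a..b}" "t \<in> {a..b}"
    have "h (f t) (g t) - h (f s) (g s) = h (f t - f s) (g t) + h (f s) (g t - g s)"
      by (simp add: bounded_bilinear.diff_left[OF h] bounded_bilinear.diff_right[OF h])
    then have "norm (h (f t) (g t) - h (f s) (g s)) \<le> norm (f t - f s) * norm (g t) * K + norm (f s) * norm (g t - g s) * K"
      using K(2) norm_triangle_le add_mono by metis
    also have "\<dots> \<le> norm (f t - f s) * (\<bar>Mf\<bar> + \<bar>Mg\<bar>) * K + (\<bar>Mf\<bar> + \<bar>Mg\<bar>) * norm (g t - g s) * K"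
      using Mf[OF st(1)] Mg[OF st(2)] K(1) by (intro add_mono mult_right_mono mult_left_mono) auto
    also have "\<dots> = (\<bar>Mf\<bar> + \<bar>Mg\<bar>) * K * (norm (f t - f s) + norm (g t - g s))"
      by (simp add: algebra_simps)
    finally show "norm (h (f t) (g t) - h (f s) (g s)) \<le> \<dots>" .
  qed
qed

text \<open>Multiplication by \<open>c\<close> carries divisions to divisions, since an injective
  linear map of the line commutes with interiors, and it multiplies the total length by
  \<open>c\<close>; so \<open>d / c\<close> serves as the new threshold.\<close>

lemma absolutely_continuous_on_scale:
  fixes f :: "real \<Rightarrow> 'a::real_normed_vector"
  assumes f: "absolutely_continuous_on {0..c * b} f" and c: "c > 0"
  shows "absolutely_continuous_on {0..b} (\<lambda>t. f (c * t))"
  unfolding absolutely_continuous_on_def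
proof (intro allI impI)
  fix \<epsilon> :: real assume "\<epsilon> > 0"
  then obtain d where d: "d > 0" "\<And>\<D>. \<D> division_of \<Union>\<D> \<and> \<Union>\<D> \<subseteq> {0..c * b} \<and> (\<Sum>K\<in>\<D>. Sup K - Inf K) < d \<Longrightarrow>
        (\<Sum>K\<in>\<D>. norm (f (Sup K) - f (Inf K))) < \<epsilon>"
    using f unfolding absolutely_continuous_on_def by blast
  show "\<exists>\<delta>>0. \<forall>\<D>. \<D> division_of \<Union>\<D> \<and> \<Union>\<D> \<subseteq> {0..b} \<and> (\<Sum>K\<in>\<D>. Sup K - Inf K) < \<delta> \<longrightarrow>
        (\<Sum>K\<in>\<D>. norm (f (c * Sup K) - f (c * Inf K))) < \<epsilon>"
  proof (intro exI[of _ "d / c"] conjI allI impI)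
    show "d / c > 0" using d c by simp
    fix \<D> assume D: "\<D> division_of \<Union>\<D> \<and> \<Union>\<D> \<subseteq> {0..b} \<and> (\<Sum>K\<in>\<D>. Sup K - Inf K) < d / c"
    define J where "J K = (*) c ` K" for K :: "real set"
    have inj: "inj ((*) c)" using c by (auto intro: injI)
    have injJ: "inj_on J \<D>" unfolding J_def using inj by (meson inj_image_eq_iff inj_onI)
    have JK: "J K = {c * Inf K..c * Sup K}" "Sup (J K) = c * Sup K" "Inf (J K) = c * Inf K" if "K \<in> \<D>" for K
    proof -
      have K: "Inf K \<le> Sup K" "{Inf K..Sup K} = K" using division_interval_endpoints[of \<D> "{0..b}" K] D that by auto
      have "J {Inf K..Sup K} = {c * Inf K..c * Sup K}"
        using c K(1) by (simp add: J_def)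
      then show "J K = {c * Inf K..c * Sup K}" using K by simp
      then show "Sup (J K) = c * Sup K" "Inf (J K) = c * Inf K" using c K(1) by auto
    qed
    have div: "(J ` \<D>) division_of \<Union>(J ` \<D>)"
      unfolding division_of_def
    proof (intro conjI ballI impI)
      show "finite (J ` \<D>)" using D by auto
      fix L assume "L \<in> J ` \<D>"
      then obtain K where K: "K \<in> \<D>" "L = J K" by auto
      show "L \<subseteq> \<Union> (J ` \<D>)" using K by auto
      show "L \<noteq> {}" using K D by (auto simp: J_def)
      show "\<exists>a b. L = cbox a b" using JK[OF K(1)] K(2) by (auto simp: box_real)
      fix L' assume "L' \<in> J ` \<D>" "L \<noteq> L'"
      then obtain K' where K': "K' \<in> \<D>" "L' = J K'" "K \<noteq> K'" using K by auto
      then have "interior K \<inter> interior K' = {}" using D K by (meson division_ofD(5))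
      moreover have "interior (J S) = J (interior S)" for S
        unfolding J_def using interior_injective_linear_image[of "(*) c" S] inj
        by (auto simp: linear_times)
      ultimately show "interior L \<inter> interior L' = {}"
        using K K' inj unfolding J_def by (metis image_Int image_empty)
    qed auto
    have "\<Union>(J ` \<D>) \<subseteq> {0..c * b}" using D c by (auto simp: J_def)
    moreover have "(\<Sum>K\<in>J ` \<D>. Sup K - Inf K) = c * (\<Sum>K\<in>\<D>. Sup K - Inf K)"
      by (simp only: sum.reindex[OF injJ] sum_distrib_left right_diff_distrib o_def JK(2,3) cong: sum.cong)
    moreover have "\<dots> < d" using D c by (simp add: pos_less_divide_eq mult.commute)
    ultimately have "(\<Sum>K\<in>J ` \<D>. norm (f (Sup K) - f (Inf K))) < \<epsilon>"
      using d(2) div by simp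
    then show "(\<Sum>K\<in>\<D>. norm (f (c * Sup K) - f (c * Inf K))) < \<epsilon>"
      by (simp only: sum.reindex[OF injJ] o_def JK(2,3) cong: sum.cong)
  qed
qed

text \<open>
  Cousin's lemma: on the intervals of a fine tagged division with tag outside \<open>N\<close> the derivative
  controls the increment, and those with tag in \<open>N\<close> lie in an open set of small measure, so absolute
  continuity controls them.
\<close>

lemma absolutely_continuous_deriv_nonpos_imp_nonincreasing:
  fixes f :: "real \<Rightarrow> real"
  assumes ac: "absolutely_continuous_on {a..b} f" and "a \<le> b" and N: "negligible N"
    and der: "\<And>t. t \<in> {a..b} - N \<Longrightarrow> (f has_real_derivative D t) (at t within {a..b})"
    and D: "\<And>t. t \<in> {a..b} - N \<Longrightarrow> D t \<le> 0"
  shows "f b \<le> f a"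
proof (rule field_le_epsilon)
  fix \<epsilon>' :: real assume "\<epsilon>' > 0"
  \<comment> \<open>The intervals with tag in \<open>N\<close> will contribute at most
    \<open>\<epsilon>\<close> and the others at most \<open>\<epsilon> * (b - a)\<close>.\<close>
  define \<epsilon> where "\<epsilon> = \<epsilon>' / (1 + (b - a))"
  have "\<epsilon> > 0" using \<open>\<epsilon>' > 0\<close> \<open>a \<le> b\<close> by (simp add: \<epsilon>_def)
  then obtain \<delta> where \<delta>: "\<delta> > 0" "\<And>\<D>. \<D> division_of \<Union>\<D> \<and> \<Union>\<D> \<subseteq> {a..b} \<and> (\<Sum>K\<in>\<D>. Sup K - Inf K) < \<delta> \<Longrightarrow>
        (\<Sum>K\<in>\<D>. norm (f (Sup K) - f (Inf K))) < \<epsilon>"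
    using ac unfolding absolutely_continuous_on_def by blast
  have Nnull: "N \<in> null_sets lebesgue" using N by (simp add: negligible_iff_null_sets)
  obtain U where U: "open U" "N \<subseteq> U" "U - N \<in> lmeasurable" "emeasure lebesgue (U - N) < ennreal \<delta>"
    using sets_lebesgue_outer_open[of N \<delta>] Nnull \<delta>(1) by blast
  have UN: "U = (U - N) \<union> N" using U by auto
  have Ulm: "U \<in> lmeasurable" 
    using UN U(3) N by (metis fmeasurable.Un negligible_imp_measurable)
  have "emeasure lebesgue U = emeasure lebesgue (U - N)"
    using emeasure_Un_null_set[of "U - N" lebesgue N] UN Nnull U(3) by auto
  then have Umeas: "measure lebesgue U < \<delta>"
    using U(4) \<delta>(1) Ulm by (metis emeasure_eq_measure2 ennreal_less_iff measure_nonneg)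
  \<comment> \<open>\<open>P t r\<close> says that the radius \<open>r\<close> is good for the gauge
    at \<open>t\<close>. For tags outside both \<open>N\<close> and \<open>{a..b}\<close> the
    condition is vacuous.\<close>
  define P where "P t r \<longleftrightarrow> r > 0 \<and> (if t \<in> N then ball t r \<subseteq> U
          else \<forall>u v. u \<le> t \<and> t \<le> v \<and> {u..v} \<subseteq> ball t r \<inter> {a..b} \<longrightarrow> f v - f u \<le> \<epsilon> * (v - u))" for t r
  have "\<exists>r. P t r" for t
  proof (cases "t \<in> N")
    case True
    then obtain r where "r > 0" "ball t r \<subseteq> U" using openE[OF U(1), of t] U(2) by blast
    then show ?thesis using True unfolding P_def by auto
  next
    case nN: False
    show ?thesis
    proof (cases "t \<in> {a..b}")
      case False
      then have "\<not> {u..v} \<subseteq> ball t 1 \<inter> {a..b}" if "u \<le> t" "t \<le> v" for u v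
        using that by auto
      then show ?thesis using nN unfolding P_def by (intro exI[of _ 1]) auto
    next
      case True
      have "(f has_derivative (\<lambda>h. D t * h)) (at t within {a..b})"
        using der[of t] True nN by (simp add: has_field_derivative_def)
      then obtain r where r: "r > 0" "\<And>y. y \<in> {a..b} \<Longrightarrow> norm (y - t) < r \<Longrightarrow> norm (f y - f t - D t * (y - t)) \<le> \<epsilon> * norm (y - t)"
        using \<open>\<epsilon> > 0\<close> unfolding has_derivative_within_alt by blast
      \<comment> \<open>Straddle estimate: the errors of linearisation at \<open>u\<close> and
        \<open>v\<close> add up to at most \<open>\<epsilon> * (v - u)\<close>, and the linear part
        \<open>D t * (v - u)\<close> is nonpositive.\<close>
      have "f v - f u \<le> \<epsilon> * (v - u)" if uv: "u \<le> t" "t \<le> v" "{u..v} \<subseteq> ball t r \<inter> {a..b}" for u v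
      proof -
        have "u \<in> ball t r \<inter> {a..b}" "v \<in> ball t r \<inter> {a..b}"
          using uv by (meson atLeastAtMost_iff order_refl order_trans subsetD)+
        then have "norm (f v - f t - D t * (v - t)) \<le> \<epsilon> * norm (v - t)" "norm (f u - f t - D t * (u - t)) \<le> \<epsilon> * norm (u - t)"
          using r(2)[of v] r(2)[of u] by (auto simp: dist_real_def abs_minus_commute)
        then have "f v - f t - D t * (v - t) \<le> \<epsilon> * (v - t)" "- (f u - f t - D t * (u - t)) \<le> \<epsilon> * (t - u)"
          using uv by auto
        moreover have "D t * (v - u) \<le> 0"
          using D[of t] True nN uv by (intro mult_nonpos_nonneg) auto
        ultimately show ?thesis by (simp add: algebra_simps)
      qed
      then show ?thesis using nN r(1) unfolding P_def by auto
    qed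
  qed
  then obtain r where "\<And>t. P t (r t)" using choice[of P] by blast
  note r0 = this[unfolded P_def]
  have r: "\<And>t. r t > 0" "\<And>t. t \<in> N \<Longrightarrow> ball t (r t) \<subseteq> U"
     "\<And>t u v. t \<notin> N \<Longrightarrow> u \<le> t \<Longrightarrow> t \<le> v \<Longrightarrow> {u..v} \<subseteq> ball t (r t) \<inter> {a..b} \<Longrightarrow> f v - f u \<le> \<epsilon> * (v - u)"
  proof -
    show "r t > 0" for t using r0 by simp
    show "ball t (r t) \<subseteq> U" if "t \<in> N" for t using r0[of t] that by simp
    show "f v - f u \<le> \<epsilon> * (v - u)" if "t \<notin> N" "u \<le> t" "t \<le> v" "{u..v} \<subseteq> ball t (r t) \<inter> {a..b}" for t u v
      using r0[of t] that unfolding if_not_P[OF that(1)] by blast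
  qed
  obtain p where p: "p tagged_division_of {a..b}" "(\<lambda>t. ball t (r t)) fine p"
    using fine_division_exists_real[OF gauge_ball_dependent] r(1) by metis
  define q where "q = {(t,K) \<in> p. t \<in> N}"
  have fin: "finite p" using p(1) by auto
  have qp: "q \<subseteq> p" by (auto simp: q_def)
  have pK: "Inf K \<le> t \<and> t \<le> Sup K \<and> {Inf K..Sup K} = K \<and> K \<subseteq> ball t (r t) \<inter> {a..b}" if "(t, K) \<in> p" for t K
  proof -
    have "t \<in> K" "K \<subseteq> {a..b}" "\<exists>u v. K = cbox u v"
      using tagged_division_ofD(2-4)[OF p(1) \<open>(t, K) \<in> p\<close>] by blast+
    then obtain u v where "K = cbox u v" "t \<in> K" "K \<subseteq> {a..b}" by blast
    moreover have "K \<subseteq> ball t (r t)" using p(2) that by (auto simp: fine_def)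
    ultimately show ?thesis by auto
  qed
  have "f b - f a = (\<Sum>(t,K)\<in>p. f (Sup K) - f (Inf K))"
    using additive_tagged_division_1[OF \<open>a \<le> b\<close> p(1), of f] by simp
  also have "\<dots> = (\<Sum>(t,K)\<in>p - q. f (Sup K) - f (Inf K)) + (\<Sum>(t,K)\<in>q. f (Sup K) - f (Inf K))"
    using sum.subset_diff[OF qp fin] .
  finally have 0: "f b - f a = (\<Sum>(t,K)\<in>p - q. f (Sup K) - f (Inf K)) + (\<Sum>(t,K)\<in>q. f (Sup K) - f (Inf K))" .
  have "(\<Sum>(t,K)\<in>p - q. f (Sup K) - f (Inf K)) \<le> (\<Sum>(t,K)\<in>p - q. \<epsilon> * (Sup K - Inf K))"
  proof (rule sum_mono, clarify)
    fix t K assume "(t, K) \<in> p" "(t, K) \<notin> q"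
    then show "f (Sup K) - f (Inf K) \<le> \<epsilon> * (Sup K - Inf K)"
      using pK[of t K] by (intro r(3)[of t]) (auto simp: q_def)
  qed
  also have "\<dots> \<le> (\<Sum>(t,K)\<in>p. \<epsilon> * (Sup K - Inf K))"
    using fin pK \<open>\<epsilon> > 0\<close> 
  proof (intro sum_mono2)
    fix z assume "z \<in> p - (p - q)"
    then have "Inf (snd z) \<le> fst z \<and> fst z \<le> Sup (snd z)" using pK[of "fst z" "snd z"] by auto
    then show "0 \<le> (case z of (t, K) \<Rightarrow> \<epsilon> * (Sup K - Inf K))"
      using \<open>\<epsilon> > 0\<close> by (auto simp: case_prod_unfold)
  qed auto
  also have "\<dots> = \<epsilon> * (b - a)"
    using additive_tagged_division_1[OF \<open>a \<le> b\<close> p(1), of "\<lambda>t. t"]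
    by (simp add: case_prod_unfold flip: sum_distrib_left)
  finally have 1: "(\<Sum>(t,K)\<in>p - q. f (Sup K) - f (Inf K)) \<le> \<epsilon> * (b - a)" .
  have 2: "(\<Sum>(t,K)\<in>q. f (Sup K) - f (Inf K)) \<le> \<epsilon>"
  proof -
    have qpart: "q tagged_division_of \<Union>(snd ` q)"
      using tagged_partial_division_subset[OF tagged_division_of_def[THEN iffD1, OF p(1), THEN conjunct1] qp]
      by (rule tagged_partial_division_of_Union_self)
    define \<D> where "\<D> = snd ` q"
    have div: "\<D> division_of \<Union>\<D>" using division_of_tagged_division[OF qpart] by (simp add: \<D>_def)
    have "K \<subseteq> {a..b} \<and> K \<subseteq> U" if "K \<in> \<D>" for K
    proof -
      obtain t where t: "(t, K) \<in> p" "t \<in> N" using \<open>K \<in> \<D>\<close> by (auto simp: \<D>_def q_def)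
      show ?thesis using pK[OF t(1)] r(2)[OF t(2)] by (meson le_infE order_trans)
    qed
    then have sub: "\<Union>\<D> \<subseteq> {a..b}" "\<Union>\<D> \<subseteq> U" by blast+
    have red: "(\<Sum>(t,K)\<in>q. f (Sup K) - f (Inf K)) = (\<Sum>K\<in>\<D>. f (Sup K) - f (Inf K))"
    proof -
      \<comment> \<open>Dropping the tags requires a summand that vanishes on every box with empty
        interior. This includes the empty box, where the increment between \<open>Inf\<close> and
        \<open>Sup\<close> means nothing, so the value 0 is forced there.\<close>
      let ?d = "\<lambda>K. if K = {} then 0 else f (Sup K) - f (Inf K)"
      have ne: "K \<noteq> {}" if "(t, K) \<in> p" for t K using pK[OF that] by auto
      have "(\<Sum>(t,K)\<in>q. f (Sup K) - f (Inf K)) = (\<Sum>(t,K)\<in>q. ?d K)"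
        using ne qp by (intro sum.cong) auto
      also have "\<dots> = (\<Sum>K\<in>\<D>. ?d K)"
        unfolding \<D>_def
      proof (rule sum.over_tagged_division_lemma[OF qpart])
        fix u v :: real assume "box u v = {}"
        then have "v \<le> u" by (simp add: not_less)
        then show "?d (cbox u v) = 0" by (cases "u = v") auto
      qed
      also have "\<dots> = (\<Sum>K\<in>\<D>. f (Sup K) - f (Inf K))"
        using ne qp by (intro sum.cong) (auto simp: \<D>_def)
      finally show ?thesis .
    qed
    have "(\<Sum>K\<in>\<D>. Sup K - Inf K) = (\<Sum>K\<in>\<D>. measure lebesgue K)"
    proof (rule sum.cong)
      fix K assume "K \<in> \<D>"
      then obtain t where "(t, K) \<in> p" using qp by (auto simp: \<D>_def)
      then have K: "{Inf K..Sup K} = K" "Inf K \<le> Sup K" using pK by (blast, force)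
      have "measure lebesgue {u..v} = v - u" if "u \<le> v" for u v :: real using that by simp
      from this[OF K(2)] show "Sup K - Inf K = measure lebesgue K" unfolding K(1) by (rule sym)
    qed simp
    also have "\<dots> = measure lebesgue (\<Union>\<D>)" using content_division[OF div] .
    also have "\<dots> \<le> measure lebesgue U"
      using sub(2) Ulm lmeasurable_division[OF div] by (intro measure_mono_fmeasurable) auto
    finally have "(\<Sum>K\<in>\<D>. norm (f (Sup K) - f (Inf K))) < \<epsilon>"
      using \<delta>(2) div sub(1) Umeas by auto
    moreover have "(\<Sum>K\<in>\<D>. f (Sup K) - f (Inf K)) \<le> (\<Sum>K\<in>\<D>. norm (f (Sup K) - f (Inf K)))"
      by (intro sum_mono) auto
    ultimately show ?thesis using red by simp
  qed
  have "f b - f a \<le> \<epsilon> * (1 + (b - a))" using 0 1 2 by (simp add: algebra_simps)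
  also have "\<dots> = \<epsilon>'" using \<open>a \<le> b\<close> by (simp add: \<epsilon>_def)
  finally show "f b \<le> f a + \<epsilon>'" by simp
qed

section \<open>Differentiation of the integral\<close>

text \<open>Vitali covering argument. Enclose \<open>{t. g t < p}\<close> in an open set
  \<open>U\<close> with little excess. On a ball inside \<open>U\<close> whose slope exceeds
  \<open>q\<close>, the function \<open>g\<close> can exceed \<open>p\<close> only on the excess, so
  the excess fills a definite proportion of the ball. Disjoint such balls then have small total
  measure, yet they cover almost all of the exceptional set. The balls need only contain
  \<open>t\<close>, not be centred there: one-sided difference quotients will be needed.\<close>

lemma negligible_large_slopes:
  fixes F g :: "real \<Rightarrow> real"
  assumes g: "g \<in> borel_measurable lebesgue"
    and bd: "\<And>t. t \<in> {a..b} \<Longrightarrow> \<bar>g t\<bar> \<le> M"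
    and F: "\<And>u v. a \<le> u \<Longrightarrow> u \<le> v \<Longrightarrow> v \<le> b \<Longrightarrow> (g has_integral (F v - F u)) {u..v}"
    and "p < q"
  shows "negligible {t \<in> {a<..<b}. g t < p \<and>
           (\<forall>d>0. \<exists>c r. 0 < r \<and> r < d \<and> t \<in> cball c r \<and> q * (2 * r) < F (c + r) - F (c - r))}"
    (is "negligible ?E")
  unfolding negligible_outer_le
proof (intro allI impI)
  fix e :: real assume "e > 0"
  \<comment> \<open>\<open>N\<close> bounds \<open>g - p\<close> on the interval. The choice of
    \<open>\<epsilon>\<close> makes \<open>(N + 1) * \<epsilon>\<close> equal to
    \<open>(q - p) * e\<close>, and \<open>N + 1\<close> avoids division by zero.\<close>
  define N where "N = \<bar>M\<bar> + \<bar>p\<bar>"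
  define \<epsilon> where "\<epsilon> = e * (q - p) / (N + 1)"
  have "N \<ge> 0" by (simp add: N_def)
  have "\<epsilon> > 0" using \<open>e > 0\<close> \<open>p < q\<close> \<open>N \<ge> 0\<close> by (simp add: \<epsilon>_def)
  define G where "G = {t. g t < p}"
  have G: "G \<in> sets lebesgue"
    using measurable_sets[OF g, of "{..<p}"] by (simp add: G_def vimage_def)
  then obtain U where U: "open U" "G \<subseteq> U" "U - G \<in> lmeasurable" "emeasure lebesgue (U - G) < ennreal \<epsilon>"
    using sets_lebesgue_outer_open \<open>\<epsilon> > 0\<close> by blast
  then have UG: "measure lebesgue (U - G) < \<epsilon>"
    by (metis emeasure_eq_measure2 ennreal_less_iff measure_nonneg)
  define K where "K = {(c, r). 0 < r \<and> cball c r \<subseteq> U \<inter> {a<..<b} \<and> q * (2 * r) < F (c + r) - F (c - r)}"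
  have Icc: "cball c r = {c - r..c + r}" for c r :: real
    by (rule cball_eq_atLeastAtMost)
  have avg: "(q - p) * (2 * r) \<le> N * measure lebesgue (cball c r \<inter> (U - G))" if "(c, r) \<in> K" for c r
  proof -
    have cr: "0 < r" "cball c r \<subseteq> U" "q * (2 * r) < F (c + r) - F (c - r)"
      "{c - r..c + r} \<subseteq> {a<..<b}"
      using that by (auto simp: K_def Icc)
    then have "c - r \<in> {a<..<b}" "c + r \<in> {a<..<b}"
      by (meson subsetD atLeastAtMost_iff order_refl add_increasing2 diff_left_mono less_imp_le
          diff_add_cancel le_add_same_cancel1 order_trans diff_le_eq)+
    then have cr': "a < c - r" "c + r < b" by auto
    have "cball c r \<inter> (U - G) \<in> lmeasurable"
      using U(3) by (simp add: fmeasurable_Int_fmeasurable)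
    then have "((\<lambda>t. p + N * indicator (cball c r \<inter> (U - G)) t) has_integral
        (p * (2 * r) + N * measure lebesgue (cball c r \<inter> (U - G)))) {c - r..c + r}"
    proof (intro has_integral_add has_integral_mult_right)
      show "((\<lambda>t. p) has_integral p * (2 * r)) {c - r..c + r}"
        using has_integral_const_real[of p "c - r" "c + r"] cr(1) by (simp add: mult.commute)
      assume "cball c r \<inter> (U - G) \<in> lmeasurable"
      then have "(indicator (cball c r \<inter> (U - G)) has_integral measure lebesgue (cball c r \<inter> (U - G))) (UNIV :: real set)"
        by (simp add: lmeasurable_iff_has_integral)
      moreover have "indicat_real (cball c r \<inter> (U - G))
          = (\<lambda>t. if t \<in> {c - r..c + r} then indicator (cball c r \<inter> (U - G)) t else 0)"
        by (auto simp: fun_eq_iff indicator_def Icc)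
      ultimately show "(indicat_real (cball c r \<inter> (U - G)) has_integral measure lebesgue (cball c r \<inter> (U - G))) {c - r..c + r}"
        by (subst has_integral_restrict_UNIV[symmetric]) simp
    qed
    moreover have "(g has_integral (F (c + r) - F (c - r))) {c - r..c + r}"
      using cr' cr(1) by (intro F) auto
    \<comment> \<open>On \<open>G\<close> the value of \<open>g\<close> is below \<open>p\<close>;
      the other points of the ball lie in \<open>U - G\<close>, where \<open>N\<close> covers the
      difference.\<close>
    moreover have "g t \<le> p + N * indicator (cball c r \<inter> (U - G)) t" if "t \<in> {c - r..c + r}" for t
    proof (cases "t \<in> G")
      case False
      then have "t \<in> cball c r \<inter> (U - G)" using that cr(2) by (auto simp: Icc)
      moreover have "\<bar>g t\<bar> \<le> M" using that cr' by (intro bd) auto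
      ultimately show ?thesis by (simp add: N_def)
    qed (use \<open>N \<ge> 0\<close> in \<open>auto simp: G_def intro: add_increasing2\<close>)
    ultimately have "F (c + r) - F (c - r) \<le> p * (2 * r) + N * measure lebesgue (cball c r \<inter> (U - G))"
      using has_integral_le by blast
    then show ?thesis using cr(3) by (simp add: algebra_simps)
  qed
  have cover: "\<exists>i. i \<in> K \<and> t \<in> cball (fst i) (snd i) \<and> snd i < d" if t: "t \<in> ?E" and "d > 0" for t d
  proof -
    have "t \<in> U \<inter> {a<..<b}" using t U(2) by (auto simp: G_def)
    moreover have "open (U \<inter> {a<..<b})" using U(1) by auto
    ultimately obtain \<rho> where \<rho>: "\<rho> > 0" "ball t \<rho> \<subseteq> U \<inter> {a<..<b}" by (meson openE)
    \<comment> \<open>A ball of radius below \<open>\<rho> / 2\<close> that contains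
      \<open>t\<close> has diameter below \<open>\<rho>\<close>, hence stays inside
      \<open>ball t \<rho>\<close>.\<close>
    obtain c r where cr: "0 < r" "r < min d (\<rho> / 2)" "t \<in> cball c r" "q * (2 * r) < F (c + r) - F (c - r)"
    proof -
      have "min d (\<rho> / 2) > 0" using \<open>d > 0\<close> \<rho>(1) by simp
      then show ?thesis using t that by blast
    qed
    have "cball c r \<subseteq> ball t \<rho>"
      using cr(2,3) by (auto simp: dist_real_def)
    then have "(c, r) \<in> K" using cr \<rho> by (auto simp: K_def)
    then show ?thesis using cr by force
  qed
  obtain C where C: "countable C" "C \<subseteq> K"
     "pairwise (\<lambda>i j. disjnt (cball (fst i) (snd i)) (cball (fst j) (snd j))) C"
     "negligible (?E - (\<Union>i\<in>C. cball (fst i) (snd i)))"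
  proof (rule Vitali_covering_theorem_cballs[of K snd ?E fst])
    show "0 < snd i" if "i \<in> K" for i using that by (auto simp: K_def)
    show "\<exists>i. i \<in> K \<and> x \<in> cball (fst i) (snd i) \<and> snd i < d" if "x \<in> ?E" "0 < d" for x d
      using cover that .
  qed (rule that)
  define V where "V = (\<Union>i\<in>C. cball (fst i) (snd i))"
  \<comment> \<open>A bound uniform over finite subfamilies passes to the countable union.\<close>
  have bound: "measure lebesgue (\<Union>i\<in>I. cball (fst i) (snd i)) \<le> e" if I: "I \<subseteq> C" "finite I" for I
  proof -
    have IK: "i \<in> K" if "i \<in> I" for i using that I C(2) by auto
    have "(q - p) * measure lebesgue (\<Union>i\<in>I. cball (fst i) (snd i))
        \<le> (q - p) * (\<Sum>i\<in>I. measure lebesgue (cball (fst i) (snd i)))"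
      using I \<open>p < q\<close> by (intro mult_left_mono measure_UNION_le) auto
    also have "\<dots> = (\<Sum>i\<in>I. (q - p) * (2 * snd i))"
      unfolding sum_distrib_left
    proof (rule sum.cong)
      fix i assume "i \<in> I"
      then have "0 < snd i" using IK[of i] by (auto simp: K_def)
      then show "(q - p) * measure lebesgue (cball (fst i) (snd i)) = (q - p) * (2 * snd i)"
        by (simp add: Icc)
    qed simp
    also have "\<dots> \<le> (\<Sum>i\<in>I. N * measure lebesgue (cball (fst i) (snd i) \<inter> (U - G)))"
      using IK by (intro sum_mono avg) auto
    also have "\<dots> = N * measure lebesgue (\<Union>i\<in>I. cball (fst i) (snd i) \<inter> (U - G))"
    proof -
      have "pairwise (\<lambda>i j. disjnt (cball (fst i) (snd i) \<inter> (U - G)) (cball (fst j) (snd j) \<inter> (U - G))) I"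
        using pairwise_subset[OF C(3) I(1)] by (rule pairwise_mono) (auto simp: disjnt_def)
      then show ?thesis
        using I U(3) by (subst measure_UNION') (auto simp: sum_distrib_left fmeasurable_Int_fmeasurable)
    qed
    also have "\<dots> \<le> N * measure lebesgue (U - G)"
      using U(3) I \<open>N \<ge> 0\<close>
      by (intro mult_left_mono measure_mono_fmeasurable sets.finite_UN) (auto simp: fmeasurableD)
    also have "\<dots> \<le> N * \<epsilon>" using UG \<open>N \<ge> 0\<close> by (intro mult_left_mono) auto
    also have "\<dots> \<le> (N + 1) * \<epsilon>" using \<open>\<epsilon> > 0\<close> by simp
    also have "\<dots> = (q - p) * e" using \<open>N \<ge> 0\<close> by (simp add: \<epsilon>_def)
    finally show ?thesis using \<open>p < q\<close> by simp
  qed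
  have V: "V \<in> lmeasurable" "measure lebesgue V \<le> e"
    unfolding V_def using fmeasurable_UN_bound[OF C(1) _ bound] measure_UN_bound[OF C(1) _ bound] by auto
  show "\<exists>T. ?E \<subseteq> T \<and> T \<in> lmeasurable \<and> measure lebesgue T \<le> e"
  proof (intro exI[of _ "V \<union> (?E - V)"] conjI)
    have n: "negligible (?E - V)" using C(4) by (simp add: V_def)
    then show "V \<union> (?E - V) \<in> lmeasurable" using V(1) negligible_imp_measurable by blast
    have "measure lebesgue (V \<union> (?E - V)) \<le> measure lebesgue V + measure lebesgue (?E - V)"
      using V(1) n by (intro measure_Un_le) (auto simp: fmeasurableD negligible_imp_sets)
    then show "measure lebesgue (V \<union> (?E - V)) \<le> e" using V(2) n by (simp add: negligible_imp_measure0)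
  qed auto
qed

text \<open>If the slopes over small intervals around \<open>t\<close> exceed
  \<open>g t + \<epsilon>\<close>, then rationals p < q fit between \<open>g t\<close> and
  \<open>g t + \<epsilon>\<close>, and \<open>t\<close> lies in one of countably many null sets.
  Applying this to \<open>- F\<close> and \<open>- g\<close> bounds the slopes from below.\<close>

lemma AE_has_real_derivative_integral:
  fixes F g :: "real \<Rightarrow> real"
  assumes g: "g \<in> borel_measurable lebesgue"
    and bd: "\<And>t. t \<in> {a..b} \<Longrightarrow> \<bar>g t\<bar> \<le> M"
    and F: "\<And>u v. a \<le> u \<Longrightarrow> u \<le> v \<Longrightarrow> v \<le> b \<Longrightarrow> (g has_integral (F v - F u)) {u..v}"
  shows "AE t in lebesgue. t \<in> {a<..<b} \<longrightarrow> (F has_real_derivative g t) (at t)"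
proof -
  define E where "E F g p q = {t \<in> {a<..<b}. g t < p \<and>
     (\<forall>d>0. \<exists>c r. 0 < r \<and> r < d \<and> t \<in> cball c r \<and> q * (2 * r) < F (c + r) - F (c - r))}"
    for F g :: "real \<Rightarrow> real" and p q :: real
  have n1: "negligible (E F g p q)" if "p < q" for p q
    unfolding E_def using negligible_large_slopes[OF g bd F that] by simp
  have n2: "negligible (E (\<lambda>t. - F t) (\<lambda>t. - g t) p q)" if "p < q" for p q
    unfolding E_def
  proof (rule negligible_large_slopes[OF _ _ _ that])
    show "(\<lambda>t. - g t) \<in> borel_measurable lebesgue" using g by simp
    show "\<bar>- g t\<bar> \<le> M" if "t \<in> {a..b}" for t using bd[OF that] by simp
    show "((\<lambda>t. - g t) has_integral (- F v - - F u)) {u..v}" if "a \<le> u" "u \<le> v" "v \<le> b" for u v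
      using has_integral_neg[OF F[OF that]] by simp
  qed
  define Q where "Q = {(p, q). p \<in> \<rat> \<and> q \<in> \<rat> \<and> p < (q :: real)}"
  have "countable Q" unfolding Q_def
    by (rule countable_subset[of _ "\<rat> \<times> \<rat>"]) (auto simp: countable_rat)
  define B where "B = (\<Union>(p,q)\<in>Q. E F g p q \<union> E (\<lambda>t. - F t) (\<lambda>t. - g t) p q)"
  have "negligible B" unfolding B_def
    using \<open>countable Q\<close> n1 n2 by (intro negligible_countable_Union[of "_ ` Q"] countable_image) (auto simp: Q_def)
  have slope: "\<exists>d>0. \<forall>c r. 0 < r \<and> r < d \<and> t \<in> cball c r \<longrightarrow> F (c + r) - F (c - r) \<le> (g t + \<epsilon>) * (2 * r)"
    if t: "t \<in> {a<..<b}" and "\<epsilon> > 0" and nB: "\<And>p q. (p, q) \<in> Q \<Longrightarrow> t \<notin> E F g p q"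
    for t \<epsilon> and F g :: "real \<Rightarrow> real"
  proof -
    obtain p where p: "p \<in> \<rat>" "g t < p" "p < g t + \<epsilon>" using Rats_dense_in_real[of "g t" "g t + \<epsilon>"] \<open>\<epsilon> > 0\<close> by auto
    obtain q where q: "q \<in> \<rat>" "p < q" "q < g t + \<epsilon>" using Rats_dense_in_real[OF p(3)] by auto
    have "t \<notin> E F g p q" using nB p q by (auto simp: Q_def)
    then obtain d where d: "d > 0" "\<And>c r. 0 < r \<Longrightarrow> r < d \<Longrightarrow> t \<in> cball c r \<Longrightarrow> F (c + r) - F (c - r) \<le> q * (2 * r)"
      using t p(2) unfolding E_def by (simp add: not_less) (meson linorder_not_le)
    have "F (c + r) - F (c - r) \<le> (g t + \<epsilon>) * (2 * r)" if "0 < r" "r < d" "t \<in> cball c r" for c r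
    proof -
      have "q * (2 * r) \<le> (g t + \<epsilon>) * (2 * r)" using q that by (intro mult_right_mono) auto
      then show ?thesis using d(2)[OF that] by linarith
    qed
    then show ?thesis using d(1) by blast
  qed
  have "(F has_real_derivative g t) (at t)" if t: "t \<in> {a<..<b}" "t \<notin> B" for t
    unfolding has_field_derivative_def has_derivative_at_alt
  proof (intro conjI allI impI)
    show "bounded_linear ((*) (g t))" by (rule bounded_linear_mult_right)
    fix \<epsilon> :: real assume "\<epsilon> > 0"
    have nE: "t \<notin> E F g p q" "t \<notin> E (\<lambda>t. - F t) (\<lambda>t. - g t) p q" if "(p, q) \<in> Q" for p q
      using t(2) that unfolding B_def by blast+
    obtain d1 where d1: "d1 > 0" "\<And>c r. 0 < r \<Longrightarrow> r < d1 \<Longrightarrow> t \<in> cball c r \<Longrightarrow> F (c + r) - F (c - r) \<le> (g t + \<epsilon>) * (2 * r)"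
      using slope[OF t(1) \<open>\<epsilon> > 0\<close> nE(1)] by blast
    obtain d2 where d2: "d2 > 0" "\<And>c r. 0 < r \<Longrightarrow> r < d2 \<Longrightarrow> t \<in> cball c r \<Longrightarrow> - F (c + r) - - F (c - r) \<le> (- g t + \<epsilon>) * (2 * r)"
      using slope[OF t(1) \<open>\<epsilon> > 0\<close> nE(2)] by blast
    have *: "\<bar>F v - F u - g t * (v - u)\<bar> \<le> \<epsilon> * (v - u)" if "u < v" "u \<le> t" "t \<le> v" "v - u < min d1 d2" for u v
    proof -
      \<comment> \<open>The interval from \<open>u\<close> to \<open>v\<close> is a ball around its
        midpoint; \<open>t\<close> may be one of its endpoints, as in a difference quotient.\<close>
      have c: "(u + v) / 2 + (v - u) / 2 = v" "(u + v) / 2 - (v - u) / 2 = u" "2 * ((v - u) / 2) = v - u" by (auto simp: field_simps)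
      have "t \<in> cball ((u + v) / 2) ((v - u) / 2)"
        unfolding cball_eq_atLeastAtMost c using that by auto
      then have "F v - F u \<le> (g t + \<epsilon>) * (v - u)" "- F v - - F u \<le> (- g t + \<epsilon>) * (v - u)"
        using d1(2)[of "(v - u) / 2" "(u + v) / 2", unfolded c] d2(2)[of "(v - u) / 2" "(u + v) / 2", unfolded c] that
        by auto
      then show ?thesis by (simp add: algebra_simps abs_le_iff)
    qed
    show "\<exists>d>0. \<forall>y. norm (y - t) < d \<longrightarrow> norm (F y - F t - g t * (y - t)) \<le> \<epsilon> * norm (y - t)"
    proof (intro exI[of _ "min d1 d2"] conjI allI impI)
      show "min d1 d2 > 0" using d1 d2 by simp
      fix y assume y: "norm (y - t) < min d1 d2"
      consider "y = t" | "t < y" | "y < t" by linarith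
      then show "norm (F y - F t - g t * (y - t)) \<le> \<epsilon> * norm (y - t)"
      proof cases
        case 2 then show ?thesis using *[of t y] y by auto
      next
        case 3 
        have "F y - F t - g t * (y - t) = - (F t - F y - g t * (t - y))" by (simp add: algebra_simps)
        then show ?thesis using *[of y t] y 3 by auto
      qed auto
    qed
  qed
  then show ?thesis
    using \<open>negligible B\<close> by (intro AE_I'[of B]) (auto simp: negligible_iff_null_sets)
qed

lemma AE_has_vector_derivative_integral:
  fixes F g :: "real \<Rightarrow> 'a::euclidean_space"
  assumes g: "g \<in> borel_measurable lebesgue"
    and bd: "\<And>t. t \<in> {a..b} \<Longrightarrow> norm (g t) \<le> M"
    and F: "\<And>u v. a \<le> u \<Longrightarrow> u \<le> v \<Longrightarrow> v \<le> b \<Longrightarrow> (g has_integral (F v - F u)) {u..v}"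
  shows "AE t in lebesgue. t \<in> {a<..<b} \<longrightarrow> (F has_vector_derivative g t) (at t)"
proof -
  have "AE t in lebesgue. \<forall>i\<in>Basis. t \<in> {a<..<b} \<longrightarrow> ((\<lambda>t. F t \<bullet> i) has_real_derivative g t \<bullet> i) (at t)"
  proof (rule AE_finite_allI[OF finite_Basis])
    fix i :: 'a assume i: "i \<in> Basis"
    show "AE t in lebesgue. t \<in> {a<..<b} \<longrightarrow> ((\<lambda>t. F t \<bullet> i) has_real_derivative g t \<bullet> i) (at t)"
    proof (rule AE_has_real_derivative_integral)
      show "(\<lambda>t. g t \<bullet> i) \<in> borel_measurable lebesgue" using g by simp
      show "\<bar>g t \<bullet> i\<bar> \<le> M" if "t \<in> {a..b}" for t
        using Basis_le_norm[OF i, of "g t"] bd[OF that] by simp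
      show "((\<lambda>t. g t \<bullet> i) has_integral F v \<bullet> i - F u \<bullet> i) {u..v}" if "a \<le> u" "u \<le> v" "v \<le> b" for u v
        using has_integral_linear[OF F[OF that] bounded_linear_inner_left[of i]]
        by (simp add: o_def inner_diff_left)
    qed
  qed
  then show ?thesis
    by (rule AE_mp) (auto intro!: AE_I2 simp: has_vector_derivative_def has_field_derivative_def
          has_derivative_componentwise_within[of F] mult_commute_abs)
qed

section \<open>Linear equations with measurable coefficients\<close>

lemma AE_lebesgue_negligibleE:
  assumes "AE t in lebesgue. P t"
  obtains N where "negligible N" "\<And>t. t \<notin> N \<Longrightarrow> P t"
proof -
  obtain N where N: "N \<in> null_sets lebesgue" "{t \<in> space lebesgue. \<not> P t} \<subseteq> N"
    using assms unfolding eventually_ae_filter by blast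
  show thesis
  proof (rule that[of N])
    show "negligible N" using N(1) by (simp add: negligible_iff_null_sets)
    show "P t" if "t \<notin> N" for t using N(2) that by auto
  qed
qed

lemma caratheodory_solutionE:
  assumes "caratheodory_solution A x"
  obtains N where "negligible N"
    "\<And>t. t \<ge> 0 \<Longrightarrow> t \<notin> N \<Longrightarrow> (x has_vector_derivative A t *v x t) (at t within {0..})"
    "\<And>b. b \<ge> 0 \<Longrightarrow> absolutely_continuous_on {0..b} x"
proof -
  obtain N where "negligible N" "\<And>t. t \<notin> N \<Longrightarrow> t \<ge> 0 \<longrightarrow> (x has_vector_derivative A t *v x t) (at t within {0..})"
    using assms by (auto simp: caratheodory_solution_def elim!: AE_lebesgue_negligibleE)
  with assms show thesis by (intro that[of N]) (auto simp: caratheodory_solution_def)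
qed

lemma absolutely_continuous_on_exp:
  "absolutely_continuous_on {a..b} (\<lambda>t. exp (c * t) :: real)"
proof (rule absolutely_continuous_on_lipschitz)
  fix s t assume "s \<in> {a..b}" "t \<in> {a..b}"
  then show "norm (exp (c * t) - exp (c * s)) \<le> (\<bar>c\<bar> * exp (\<bar>c\<bar> * (\<bar>a\<bar> + \<bar>b\<bar>))) * \<bar>t - s\<bar>"
  proof (subst real_norm_def[symmetric], intro field_differentiable_bound[of "{a..b}" _ "\<lambda>t. c * exp (c * t)"])
    fix r assume r: "r \<in> {a..b}"
    show "((\<lambda>t. exp (c * t)) has_real_derivative c * exp (c * r)) (at r within {a..b})"
      by (auto intro!: derivative_eq_intros)
    have "c * r \<le> \<bar>c\<bar> * \<bar>r\<bar>" using abs_ge_self[of "c * r"] by (simp add: abs_mult)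
    also have "\<dots> \<le> \<bar>c\<bar> * (\<bar>a\<bar> + \<bar>b\<bar>)" using r by (intro mult_left_mono) auto
    finally show "norm (c * exp (c * r)) \<le> \<bar>c\<bar> * exp (\<bar>c\<bar> * (\<bar>a\<bar> + \<bar>b\<bar>))"
      by (simp add: abs_mult mult_left_mono)
  qed auto
qed

text \<open>Gronwall argument: for the difference \<open>z\<close> the function
  \<open>exp (- (2 * L) * s) * (z s \<bullet> z s)\<close> is nonincreasing and vanishes at
  \<open>r\<close>. The free starting time \<open>r\<close> allows the conclusion that a solution
  which reaches zero remains zero.\<close>

lemma caratheodory_solution_unique:
  fixes A :: "real \<Rightarrow> real^'n^'n"
  assumes L: "\<And>t y. t \<ge> 0 \<Longrightarrow> norm (A t *v y) \<le> L * norm y"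
    and x: "caratheodory_solution A x" and y: "caratheodory_solution A y"
    and "x r = y r" "0 \<le> r" "r \<le> t"
  shows "x t = y t"
proof -
  define z where "z s = x s - y s" for s
  obtain Nx where Nx: "negligible Nx" "\<And>s. s \<ge> 0 \<Longrightarrow> s \<notin> Nx \<Longrightarrow> (x has_vector_derivative A s *v x s) (at s within {0..})"
    and acx: "\<And>b. b \<ge> 0 \<Longrightarrow> absolutely_continuous_on {0..b} x"
    by (rule caratheodory_solutionE[OF x]) (rule that)
  obtain Ny where Ny: "negligible Ny" "\<And>s. s \<ge> 0 \<Longrightarrow> s \<notin> Ny \<Longrightarrow> (y has_vector_derivative A s *v y s) (at s within {0..})"
    and acy: "\<And>b. b \<ge> 0 \<Longrightarrow> absolutely_continuous_on {0..b} y"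
    by (rule caratheodory_solutionE[OF y]) (rule that)
  have acz: "absolutely_continuous_on {r..t} z"
  proof (rule absolutely_continuous_on_dominated)
    show "absolutely_continuous_on {r..t} x" "absolutely_continuous_on {r..t} y"
      using acx[of t] acy[of t] absolutely_continuous_on_subset[of "{0..t}" _ "{r..t}"] \<open>0 \<le> r\<close> \<open>r \<le> t\<close> by auto
    show "norm (z v - z u) \<le> 1 * (norm (x v - x u) + norm (y v - y u))" for u v
      using norm_triangle_ineq4[of "x v - x u" "y v - y u"] by (simp add: z_def algebra_simps)
  qed
  have acf: "absolutely_continuous_on {r..t} (\<lambda>s. exp (- (2 * L) * s) * (z s \<bullet> z s))"
    by (intro bounded_bilinear_absolutely_continuous_on[OF bounded_bilinear_mult]
        bounded_bilinear_absolutely_continuous_on[OF bounded_bilinear_inner] acz absolutely_continuous_on_exp)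
  have "exp (- (2 * L) * t) * (z t \<bullet> z t) \<le> exp (- (2 * L) * r) * (z r \<bullet> z r)"
  proof (rule absolutely_continuous_deriv_nonpos_imp_nonincreasing[OF acf \<open>r \<le> t\<close>])
    show "negligible (Nx \<union> Ny)" using Nx Ny by simp
    fix s assume s: "s \<in> {r..t} - (Nx \<union> Ny)"
    have "(z has_vector_derivative A s *v z s) (at s within {0..})"
      unfolding z_def using s \<open>0 \<le> r\<close> Nx(2) Ny(2)
      by (auto intro!: has_vector_derivative_diff simp: matrix_vector_mult_diff_distrib)
    then have "(z has_vector_derivative A s *v z s) (at s within {r..t})"
      by (rule has_vector_derivative_within_subset) (use \<open>0 \<le> r\<close> in auto)
    then have "((\<lambda>s. z s \<bullet> z s) has_vector_derivative z s \<bullet> (A s *v z s) + (A s *v z s) \<bullet> z s) (at s within {r..t})"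
      using bounded_bilinear.has_vector_derivative[OF bounded_bilinear_inner] by blast
    then have "((\<lambda>s. z s \<bullet> z s) has_real_derivative 2 * (z s \<bullet> (A s *v z s))) (at s within {r..t})"
      by (simp add: has_real_derivative_iff_has_vector_derivative inner_commute)
    moreover have "((\<lambda>s. exp (- (2 * L) * s)) has_real_derivative - (2 * L) * exp (- (2 * L) * s)) (at s within {r..t})"
      by (auto intro!: derivative_eq_intros)
    ultimately show "((\<lambda>s. exp (- (2 * L) * s) * (z s \<bullet> z s)) has_real_derivative
        - (2 * L) * exp (- (2 * L) * s) * (z s \<bullet> z s) + 2 * (z s \<bullet> (A s *v z s)) * exp (- (2 * L) * s)) (at s within {r..t})"
      using DERIV_mult by blast
    have "z s \<bullet> (A s *v z s) \<le> norm (z s) * norm (A s *v z s)" by (rule norm_cauchy_schwarz)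
    also have "\<dots> \<le> norm (z s) * (L * norm (z s))" using L s \<open>0 \<le> r\<close> by (intro mult_left_mono) auto
    also have "\<dots> = L * (z s \<bullet> z s)" by (simp add: dot_square_norm power2_eq_square)
    finally have "2 * exp (- (2 * L) * s) * (z s \<bullet> (A s *v z s)) \<le> 2 * exp (- (2 * L) * s) * (L * (z s \<bullet> z s))"
      by (intro mult_left_mono) auto
    then show "- (2 * L) * exp (- (2 * L) * s) * (z s \<bullet> z s) + 2 * (z s \<bullet> (A s *v z s)) * exp (- (2 * L) * s) \<le> 0"
      by (simp add: algebra_simps)
  qed
  also have "\<dots> = 0" using \<open>x r = y r\<close> by (simp add: z_def)
  finally have "z t \<bullet> z t \<le> 0" by (simp add: mult_le_0_iff)
  then have "z t = 0" by (metis antisym inner_eq_zero_iff inner_ge_zero)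
  then show ?thesis by (simp add: z_def)
qed

section \<open>Existence of solutions\<close>

lemma integrable_on_continuous_bound:
  fixes g :: "real \<Rightarrow> 'a::euclidean_space"
  assumes g: "g \<in> borel_measurable lebesgue"
    and h: "continuous_on UNIV h" "\<And>t. norm (g t) \<le> h t"
  shows "g integrable_on {a..b}"
proof (rule measurable_bounded_by_integrable_imp_integrable)
  show "g \<in> borel_measurable (lebesgue_on {a..b})" using g by (simp add: measurable_restrict_space1)
  show "h integrable_on {a..b}" using h(1) by (intro integrable_continuous_real) (rule continuous_on_subset, auto)
qed (use h in auto)

text \<open>Freezing the upper limit at 0 for negative times gives a function on the whole line, so
  that the fixed point argument can take place in the space of bounded continuous functions.\<close>

lemma continuous_on_integral_max:
  fixes g :: "real \<Rightarrow> 'a::banach"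
  assumes "\<And>b. g integrable_on {0..b}"
  shows "continuous_on UNIV (\<lambda>t. integral {0..max t 0} g)"
proof -
  have "isCont (\<lambda>t. integral {0..max t 0} g) t" for t
  proof -
    have "continuous_on {..<max t 0 + 1} (\<lambda>t. integral {0..max t 0} g)"
    proof (rule continuous_on_compose2[OF indefinite_integral_continuous_1[OF assms[of "max t 0 + 1"]]])
      show "continuous_on {..<max t 0 + 1} (\<lambda>t. max t 0)" by (intro continuous_intros)
    qed auto
    then show ?thesis
      by (simp add: continuous_on_eq_continuous_at)
  qed
  then show ?thesis by (simp add: continuous_at_imp_continuous_on)
qed

lemma bounded_bilinear_matrix_vector_mult:
  "bounded_bilinear ((*v) :: real^'n^'m \<Rightarrow> real^'n \<Rightarrow> real^'m)"
  unfolding bilinear_conv_bounded_bilinear[symmetric] bilinear_def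
  by (auto intro!: linearI simp: matrix_vector_mult_add_rdistrib matrix_vector_right_distrib
      scaleR_matrix_vector_assoc matrix_vector_mult_scaleR)

lemma bounded_matrices_uniform_bound:
  fixes S :: "(real^'n^'m) set"
  assumes "bounded S"
  obtains L where "L > 0" "\<And>A y. A \<in> S \<Longrightarrow> norm (A *v y) \<le> L * norm y"
proof -
  obtain K where K: "\<And>(A :: real^'n^'m) y. norm (A *v y) \<le> norm A * norm y * K" "K > 0"
    using bounded_bilinear.pos_bounded[OF bounded_bilinear_matrix_vector_mult] by blast
  obtain M where M: "M > 0" "\<And>A. A \<in> S \<Longrightarrow> norm A \<le> M" using assms by (auto simp: bounded_pos)
  show thesis
  proof
    show "M * K > 0" using M K by simp
    fix A y assume "A \<in> S"
    have "norm (A *v y) \<le> norm A * norm y * K" by (rule K)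
    also have "\<dots> \<le> M * norm y * K" using M \<open>A \<in> S\<close> K(2) by (intro mult_right_mono) auto
    finally show "norm (A *v y) \<le> M * K * norm y" by (simp add: mult_ac)
  qed
qed

lemma borel_measurable_matrix_vector_mult:
  fixes A :: "real \<Rightarrow> real^'n^'m"
  assumes A: "A \<in> borel_measurable lebesgue" and "continuous_on UNIV y"
  shows "(\<lambda>s. A s *v y s) \<in> borel_measurable lebesgue"
proof -
  have "y \<in> borel_measurable borel" using assms(2) by (rule borel_measurable_continuous_onI)
  then have "y \<in> borel_measurable lebesgue" by (simp add: measurable_completion)
  moreover have "continuous_on UNIV (\<lambda>z. (fst z :: real^'n^'m) *v snd z)"
    by (intro bounded_bilinear.continuous_on[OF bounded_bilinear_matrix_vector_mult] continuous_intros)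
  ultimately show ?thesis
    using A by (intro borel_measurable_continuous_Pair[of A _ y "(*v)"]) auto
qed

text \<open>Picard iteration for \<open>y t = exp (- K t) *\<^sub>R x t\<close>, which contracts on all of the half-line at once.\<close>

lemma bounded_measurable_integral_equation:
  fixes A :: "real \<Rightarrow> real^'n^'n" and w :: "real^'n"
  assumes A: "A \<in> borel_measurable lebesgue" and "L > 0"
    and L: "\<And>t y. norm (A t *v y) \<le> L * norm y"
  obtains x where "continuous_on UNIV x" "\<And>t. t \<ge> 0 \<Longrightarrow> x t = w + integral {0..t} (\<lambda>s. A s *v x s)"
proof -
  \<comment> \<open>The iteration contracts by the factor \<open>L / K\<close>; this choice makes it
    1/2.\<close>
  define K where "K = 2 * L"
  have "K > 0" using \<open>L > 0\<close> by (simp add: K_def)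
  \<comment> \<open>\<open>G y\<close> is the integrand for the unweighted function:
    \<open>A s\<close> applied to \<open>exp (K * s) *\<^sub>R y s\<close>.\<close>
  define G where "G y s = exp (K * s) *\<^sub>R (A s *v y s)" for y :: "real \<Rightarrow> real^'n" and s
  define \<Phi> where "\<Phi> y t = exp (- K * max t 0) *\<^sub>R (w + integral {0..max t 0} (G y))" for y t
  have meas: "G y \<in> borel_measurable lebesgue" if "continuous_on UNIV y" for y
    using borel_measurable_matrix_vector_mult[OF A that] unfolding G_def
    by (intro borel_measurable_scaleR) (auto intro!: measurable_completion borel_measurable_continuous_onI continuous_intros)
  have bound: "norm (G y s) \<le> L * M * exp (K * s)" if "\<And>s. norm (y s) \<le> M" for y s M
  proof -
    have "norm (G y s) \<le> exp (K * s) * (L * norm (y s))"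
      using L by (simp add: G_def)
    also have "\<dots> \<le> exp (K * s) * (L * M)" using that \<open>L > 0\<close> by (intro mult_left_mono) auto
    finally show ?thesis by (simp add: mult_ac)
  qed
  have int: "G y integrable_on {a..b}" if "continuous_on UNIV y" "\<And>s. norm (y s) \<le> M" for y a b M
    by (rule integrable_on_continuous_bound[OF meas[OF that(1)] _ bound[OF that(2)]]) (intro continuous_intros)
  \<comment> \<open>The decisive estimate: the integral of \<open>L * M * exp (K * s)\<close> is at
    most \<open>L * M / K\<close> times the final exponential, which the weight cancels. Applied to
    a difference of two functions it is the contraction property.\<close>
  have ibound: "norm (exp (- K * max t 0) *\<^sub>R integral {0..max t 0} (G y)) \<le> M / 2"
    if "continuous_on UNIV y" "\<And>s. norm (y s) \<le> M" for y t M
  proof -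
    let ?t = "max t 0"
    have "M \<ge> 0" using order_trans[OF norm_ge_zero that(2)] .
    have "((\<lambda>s. L * M * exp (K * s)) has_integral (L * M / K * exp (K * ?t) - L * M / K * exp (K * 0))) {0..?t}"
      using \<open>K > 0\<close> by (intro fundamental_theorem_of_calculus)
       (auto intro!: derivative_eq_intros simp flip: has_real_derivative_iff_has_vector_derivative)
    then have "norm (integral {0..?t} (G y)) \<le> L * M / K * exp (K * ?t) - L * M / K * exp (K * 0)"
      using integral_norm_bound_integral[OF int[OF that] _ bound[OF that(2)]] by (metis has_integral_integrable_integral)
    also have "\<dots> \<le> M / 2 * exp (K * ?t)" using \<open>M \<ge> 0\<close> \<open>L > 0\<close> by (simp add: K_def)
    finally have "exp (- K * ?t) * norm (integral {0..?t} (G y)) \<le> exp (- K * ?t) * (M / 2 * exp (K * ?t))"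
      by (intro mult_left_mono) auto
    also have "\<dots> = M / 2" by (simp add: exp_minus)
    finally show ?thesis by simp
  qed
  have \<Phi>: "\<Phi> y \<in> bcontfun" if "continuous_on UNIV y" "\<And>s. norm (y s) \<le> M" for y M
  proof (rule bcontfun_normI)
    show "continuous_on UNIV (\<Phi> y)" unfolding \<Phi>_def
      using int[OF that] by (intro continuous_intros continuous_on_integral_max)
    fix t
    have "norm (\<Phi> y t) \<le> norm (exp (- K * max t 0) *\<^sub>R w) + norm (exp (- K * max t 0) *\<^sub>R integral {0..max t 0} (G y))"
      unfolding \<Phi>_def scaleR_add_right by (rule norm_triangle_ineq)
    also have "norm (exp (- K * max t 0) *\<^sub>R w) \<le> norm w"
      using \<open>K > 0\<close> by (simp add: mult_left_le_one_le)
    also note ibound[OF that]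
    finally show "norm (\<Phi> y t) \<le> norm w + M / 2" by simp
  qed
  define T where "T f = Bcontfun (\<Phi> (apply_bcontfun f))" for f :: "real \<Rightarrow>\<^sub>C (real^'n)"
  have T: "apply_bcontfun (T f) = \<Phi> (apply_bcontfun f)" for f
    unfolding T_def using \<Phi>[of f "norm f"] by (simp add: Bcontfun_inverse norm_bounded)
  have "\<exists>!f. T f = f"
  proof (rule banach_fix_type[of "1/2"])
    show "\<forall>f g. dist (T f) (T g) \<le> 1 / 2 * dist f g"
    proof (intro allI dist_bound)
      fix f g :: "real \<Rightarrow>\<^sub>C (real^'n)" and t
      have fg: "continuous_on UNIV (\<lambda>s. f s - g s)" "\<And>s. norm (f s - g s) \<le> dist f g"
        using dist_bounded[of f _ g] by (auto intro!: continuous_intros simp: dist_norm)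
      have "G (\<lambda>s. f s - g s) = (\<lambda>s. G f s - G g s)"
        by (simp add: G_def fun_eq_iff matrix_vector_mult_diff_distrib scaleR_diff_right)
      then have "integral {0..max t 0} (G (\<lambda>s. f s - g s)) = integral {0..max t 0} (G f) - integral {0..max t 0} (G g)"
        using int[of f "norm f"] int[of g "norm g"] by (simp add: integral_diff norm_bounded)
      then have "T f t - T g t = exp (- K * max t 0) *\<^sub>R integral {0..max t 0} (G (\<lambda>s. f s - g s))"
        by (simp add: T \<Phi>_def flip: scaleR_diff_right)
      then show "dist (T f t) (T g t) \<le> 1 / 2 * dist f g"
        using ibound[OF fg, of t] by (simp add: dist_norm)
    qed
  qed auto
  then obtain f where f: "T f = f" by blast
  show thesis
  proof
    show "continuous_on UNIV (\<lambda>t. exp (K * t) *\<^sub>R f t)" by (intro continuous_intros) simp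
    fix t :: real assume "t \<ge> 0"
    have "f t = exp (- K * t) *\<^sub>R (w + integral {0..t} (G f))"
      using fun_cong[OF T[of f], of t] \<open>t \<ge> 0\<close> by (simp add: f \<Phi>_def max_absorb1)
    then have "exp (K * t) *\<^sub>R f t = w + integral {0..t} (G f)" by (simp add: exp_minus)
    also have "G f = (\<lambda>s. A s *v (exp (K * s) *\<^sub>R f s))" by (simp add: G_def fun_eq_iff matrix_vector_mult_scaleR)
    finally show "exp (K * t) *\<^sub>R f t = w + integral {0..t} (\<lambda>s. A s *v (exp (K * s) *\<^sub>R f s))" .
  qed
qed

text \<open>A solution of the integral equation has a locally bounded integrand. It is therefore
  Lipschitz, hence absolutely continuous, on compact intervals, and differentiation of the integral
  gives the equation almost everywhere.\<close>

lemma caratheodory_solution_exists: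
  fixes A :: "real \<Rightarrow> real^'n^'n" and w :: "real^'n"
  assumes meas: "measurable_halfline A" and "L > 0"
    and L: "\<And>t y. t \<ge> 0 \<Longrightarrow> norm (A t *v y) \<le> L * norm y"
  obtains x where "caratheodory_solution A x" "x 0 = w"
proof -
  \<comment> \<open>Continued by 0, the coefficient is measurable and satisfies the bound
    \<open>L\<close> on the whole line.\<close>
  define A' where "A' t = (if t \<in> {0..} then A t else 0)" for t
  have A': "A' \<in> borel_measurable lebesgue"
    using borel_measurable_if_I[of A "{0..}"] meas unfolding A'_def measurable_halfline_def by simp
  have L': "norm (A' t *v y) \<le> L * norm y" for t y
    using L[of t y] \<open>L > 0\<close> by (simp add: A'_def)
  obtain x where cont: "continuous_on UNIV x" and x: "\<And>t. t \<ge> 0 \<Longrightarrow> x t = w + integral {0..t} (\<lambda>s. A' s *v x s)"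
    using bounded_measurable_integral_equation[OF A' \<open>L > 0\<close> L', of w] by metis
  define G where "G s = A' s *v x s" for s
  have G: "G \<in> borel_measurable lebesgue"
    unfolding G_def using A' cont by (rule borel_measurable_matrix_vector_mult)
  have int: "G integrable_on {a..b}" for a b
    unfolding G_def
  proof (rule integrable_on_continuous_bound[OF G[unfolded G_def] _ L'])
    show "continuous_on UNIV (\<lambda>t. L * norm (x t))" using cont by (intro continuous_intros)
  qed
  have F: "(G has_integral (x v - x u)) {u..v}" if "0 \<le> u" "u \<le> v" for u v
  proof -
    have "x v - x u = integral {u..v} G"
      using Henstock_Kurzweil_Integration.integral_combine[OF that int] x[of u] x[of v] that unfolding G_def[abs_def, symmetric] by (simp add: algebra_simps)
    then show ?thesis using int by (metis integrable_integral)
  qed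
  have bound: "\<exists>M\<ge>0. \<forall>t\<in>{0..b}. norm (G t) \<le> M" for b
  proof -
    have "compact (x ` {0..b})" using cont by (intro compact_continuous_image continuous_on_subset[OF cont]) auto
    then obtain M where M: "M > 0" "\<And>t. t \<in> {0..b} \<Longrightarrow> norm (x t) \<le> M"
      unfolding compact_eq_bounded_closed bounded_pos ball_simps by blast
    have "norm (G t) \<le> L * M" if "t \<in> {0..b}" for t
      unfolding G_def using L'[of t "x t"] mult_left_mono[OF M(2)[OF that], of L] \<open>L > 0\<close> by linarith
    then show ?thesis using M(1) \<open>L > 0\<close> by (intro exI[of _ "L * M"]) auto
  qed
  have "absolutely_continuous_on {0..b} x" for b
  proof -
    obtain M where M: "M \<ge> 0" "\<And>t. t \<in> {0..b} \<Longrightarrow> norm (G t) \<le> M" using bound by blast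
    have *: "norm (x v - x u) \<le> M * (v - u)" if "0 \<le> u" "u \<le> v" "v \<le> b" for u v
      using has_integral_bound_real[OF M(1) finite.emptyI F[OF that(1,2)]] M(2) that by simp
    show ?thesis
    proof (rule absolutely_continuous_on_lipschitz)
      fix u v assume "u \<in> {0..b}" "v \<in> {0..b}"
      then show "norm (x v - x u) \<le> M * \<bar>v - u\<bar>"
        using *[of u v] *[of v u] by (cases "u \<le> v") (auto simp: norm_minus_commute)
    qed
  qed
  moreover have "AE t in lebesgue. t \<ge> 0 \<longrightarrow> (x has_vector_derivative A t *v x t) (at t within {0..})"
  proof -
    \<comment> \<open>Differentiability holds inside bounded intervals; countably many of them
      exhaust the positive times, and time 0 is a null set.\<close>
    have "AE t in lebesgue. \<forall>n::nat. t \<in> {0<..<real n} \<longrightarrow> (x has_vector_derivative G t) (at t)"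
      unfolding AE_all_countable
    proof
      fix n :: nat
      obtain M where M: "M \<ge> 0" "\<And>t. t \<in> {0..real n} \<Longrightarrow> norm (G t) \<le> M" using bound by blast
      show "AE t in lebesgue. t \<in> {0<..<real n} \<longrightarrow> (x has_vector_derivative G t) (at t)"
        by (rule AE_has_vector_derivative_integral[OF G M(2)]) (auto intro: F)
    qed
    moreover have "AE t in lebesgue. t \<noteq> (0::real)"
      by (rule AE_I'[of "{0}"]) (auto simp flip: negligible_iff_null_sets)
    ultimately show ?thesis
    proof eventually_elim
      case (elim t)
      show ?case
      proof
        assume "t \<ge> 0"
        then have "t > 0" using elim by simp
        moreover obtain n :: nat where "t < real n" using reals_Archimedean2 by blast
        ultimately have "(x has_vector_derivative G t) (at t)" using elim by auto
        then show "(x has_vector_derivative A t *v x t) (at t within {0..})"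
          using \<open>t \<ge> 0\<close> by (simp add: G_def A'_def has_vector_derivative_at_within)
      qed
    qed
  qed
  ultimately have "caratheodory_solution A x" by (simp add: caratheodory_solution_def)
  moreover have "x 0 = w" using x[of 0] by simp
  ultimately show thesis by (rule that)
qed

section \<open>Operations on solutions\<close>

lemma caratheodory_solution_cong_AE:
  assumes "AE t in lebesgue. t \<ge> 0 \<longrightarrow> A t = A' t" and "caratheodory_solution A x"
  shows "caratheodory_solution A' x"
proof -
  have "AE t in lebesgue. t \<ge> 0 \<longrightarrow> (x has_vector_derivative A t *v x t) (at t within {0..})"
    using assms(2) by (simp add: caratheodory_solution_def)
  with assms(1) have "AE t in lebesgue. t \<ge> 0 \<longrightarrow> (x has_vector_derivative A' t *v x t) (at t within {0..})"
    by eventually_elim auto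
  then show ?thesis using assms(2) by (simp add: caratheodory_solution_def)
qed

lemma caratheodory_solutionI:
  assumes "negligible N"
    and "\<And>t. t \<ge> 0 \<Longrightarrow> t \<notin> N \<Longrightarrow> (x has_vector_derivative A t *v x t) (at t within {0..})"
    and "\<And>b. b \<ge> 0 \<Longrightarrow> absolutely_continuous_on {0..b} x"
  shows "caratheodory_solution A x"
  unfolding caratheodory_solution_def using assms
  by (auto intro!: AE_I'[of N] simp: negligible_iff_null_sets)

text \<open>Chain rule, together with the fact that rescaling time preserves null sets. With
  \<open>c\<close> equal to \<alpha> it puts the second planar factor on its own clock and supplies
  the factor \<alpha> of its coefficient.\<close>

lemma caratheodory_solution_scale:
  assumes x: "caratheodory_solution A x" and "c > 0"
  shows "caratheodory_solution (\<lambda>t. c *\<^sub>R A (c * t)) (\<lambda>t. x (c * t))"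
proof -
  obtain N where N: "negligible N" "\<And>s. s \<ge> 0 \<Longrightarrow> s \<notin> N \<Longrightarrow> (x has_vector_derivative A s *v x s) (at s within {0..})"
    and ac: "\<And>b. b \<ge> 0 \<Longrightarrow> absolutely_continuous_on {0..b} x"
    by (rule caratheodory_solutionE[OF x]) (rule that)
  show ?thesis
  proof (rule caratheodory_solutionI)
    show "negligible ((\<lambda>s. s / c) ` N)"
      using N(1) by (rule negligible_differentiable_image_negligible[rotated])
        (auto simp: divide_inverse intro!: derivative_intros)
    show "absolutely_continuous_on {0..b} (\<lambda>t. x (c * t))" if "b \<ge> 0" for b
      using ac[of "c * b"] that \<open>c > 0\<close> by (intro absolutely_continuous_on_scale) auto
    fix t :: real assume t: "t \<ge> 0" "t \<notin> (\<lambda>s. s / c) ` N"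
    have "c * t \<notin> N"
    proof
      assume "c * t \<in> N"
      then have "(c * t) / c \<in> (\<lambda>s. s / c) ` N" by blast
      then show False using t \<open>c > 0\<close> by simp
    qed
    then have "(x has_vector_derivative A (c * t) *v x (c * t)) (at (c * t) within {0..})"
      using N(2)[of "c * t"] t \<open>c > 0\<close> by simp
    then have "(x has_vector_derivative A (c * t) *v x (c * t)) (at (c * t) within (*) c ` {0..})"
      by (rule has_vector_derivative_within_subset) (use \<open>c > 0\<close> in auto)
    moreover have "((*) c has_vector_derivative c) (at t within {0..})"
      by (auto intro!: derivative_eq_intros simp: has_vector_derivative_def mult.commute)
    ultimately have "((x \<circ> (*) c) has_vector_derivative c *\<^sub>R (A (c * t) *v x (c * t))) (at t within {0..})"
      by (intro vector_diff_chain_within)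
    then show "((\<lambda>t. x (c * t)) has_vector_derivative (c *\<^sub>R A (c * t)) *v x (c * t)) (at t within {0..})"
      by (simp add: o_def scaleR_matrix_vector_assoc)
  qed
qed

lemma caratheodory_solution_add:
  assumes x: "caratheodory_solution A x" and y: "caratheodory_solution A y"
  shows "caratheodory_solution A (\<lambda>t. x t + y t)"
proof -
  obtain N where N: "negligible N" "\<And>s. s \<ge> 0 \<Longrightarrow> s \<notin> N \<Longrightarrow> (x has_vector_derivative A s *v x s) (at s within {0..})"
    and acx: "\<And>b. b \<ge> 0 \<Longrightarrow> absolutely_continuous_on {0..b} x"
    by (rule caratheodory_solutionE[OF x]) (rule that)
  obtain N' where N': "negligible N'" "\<And>s. s \<ge> 0 \<Longrightarrow> s \<notin> N' \<Longrightarrow> (y has_vector_derivative A s *v y s) (at s within {0..})"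
    and acy: "\<And>b. b \<ge> 0 \<Longrightarrow> absolutely_continuous_on {0..b} y"
    by (rule caratheodory_solutionE[OF y]) (rule that)
  show ?thesis
  proof (rule caratheodory_solutionI)
    show "negligible (N \<union> N')" using N N' by simp
    show "((\<lambda>t. x t + y t) has_vector_derivative A t *v (x t + y t)) (at t within {0..})" if "t \<ge> 0" "t \<notin> N \<union> N'" for t
      using N(2)[of t] N'(2)[of t] that by (auto simp: matrix_vector_right_distrib intro!: has_vector_derivative_add)
    show "absolutely_continuous_on {0..b} (\<lambda>t. x t + y t)" if "b \<ge> 0" for b
      by (rule absolutely_continuous_on_dominated[OF acx[OF that] acy[OF that], where M=1])
         (use norm_triangle_ineq in \<open>simp add: add_diff_add\<close>)
  qed
qed

lemma caratheodory_solution_scaleR: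
  assumes x: "caratheodory_solution A x"
  shows "caratheodory_solution A (\<lambda>t. c *\<^sub>R x t)"
proof -
  obtain N where N: "negligible N" "\<And>s. s \<ge> 0 \<Longrightarrow> s \<notin> N \<Longrightarrow> (x has_vector_derivative A s *v x s) (at s within {0..})"
    and ac: "\<And>b. b \<ge> 0 \<Longrightarrow> absolutely_continuous_on {0..b} x"
    by (rule caratheodory_solutionE[OF x]) (rule that)
  show ?thesis
  proof (rule caratheodory_solutionI[OF N(1)])
    show "((\<lambda>t. c *\<^sub>R x t) has_vector_derivative A t *v (c *\<^sub>R x t)) (at t within {0..})" if "t \<ge> 0" "t \<notin> N" for t
      using bounded_linear.has_vector_derivative[OF bounded_linear_scaleR_right N(2)[OF that], of c]
      by (simp add: matrix_vector_mult_scaleR)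
    show "absolutely_continuous_on {0..b} (\<lambda>t. c *\<^sub>R x t)" if "b \<ge> 0" for b
      by (rule absolutely_continuous_on_dominated[OF ac[OF that] ac[OF that], where M="\<bar>c\<bar>"])
         (simp flip: scaleR_diff_right add: distrib_left)
  qed
qed

lemma caratheodory_solution_sum:
  assumes "finite I" "\<And>i. i \<in> I \<Longrightarrow> caratheodory_solution A (x i)"
  shows "caratheodory_solution A (\<lambda>t. \<Sum>i\<in>I. x i t)"
  using assms
proof (induction I rule: finite_induct)
  case empty
  have "absolutely_continuous_on {0..b} (\<lambda>t. 0)" for b
    by (rule absolutely_continuous_on_lipschitz[where M=0]) auto
  then show ?case by (intro caratheodory_solutionI[of "{}"]) auto
next
  case (insert i I)
  then show ?case by (simp add: caratheodory_solution_add)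
qed

lemma measurable_halfline_scale:
  fixes f :: "real \<Rightarrow> 'a::euclidean_space"
  assumes "measurable_halfline f" "c > 0"
  shows "measurable_halfline (\<lambda>t. f (c * t))"
proof -
  \<comment> \<open>Continued by 0 so that the measurability of scalings of the whole line applies;
    as \<open>c\<close> is positive, the half-line is mapped to itself.\<close>
  let ?g = "\<lambda>t. if t \<in> {0..} then f t else 0"
  have "?g \<in> borel_measurable lebesgue"
    using borel_measurable_if_I[of f "{0..}"] assms(1) by (simp add: measurable_halfline_def)
  then have "(\<lambda>t. ?g (c *\<^sub>R t)) \<in> borel_measurable lebesgue"
    by (rule measurable_compose[OF lebesgue_measurable_scaling[of c], where g = ?g])
  moreover have "(\<lambda>t. ?g (c *\<^sub>R t)) = (\<lambda>t. if t \<in> {0..} then f (c * t) else 0)"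
    using assms(2) by (auto simp: fun_eq_iff zero_le_mult_iff)
  ultimately show ?thesis
    unfolding measurable_halfline_def by (intro borel_measurable_if_D) simp
qed

section \<open>Kronecker sums\<close>

text \<open>The elementary tensor of two vectors, in the lexicographic enumeration used by
  \<open>kron\<close>, so that Kronecker products act on it factor by factor.\<close>

definition tensor :: "real^2 \<Rightarrow> real^2 \<Rightarrow> real^4" where
  "tensor v w = (\<chi> i. v $ kron_fst i * w $ kron_snd i)"

lemma kron_index_simps [simp]:
  "kron_fst 1 = 1" "kron_fst 2 = 1" "kron_fst 3 = 2" "kron_fst 4 = 2"
  "kron_snd 1 = 1" "kron_snd 2 = 2" "kron_snd 3 = 1" "kron_snd 4 = 2"
  by (simp_all add: kron_fst_def kron_snd_def)

lemma kron_mult_tensor: "kron P Q *v tensor v w = tensor (P *v v) (Q *v w)"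
  by (simp add: vec_eq_iff matrix_vector_mult_def kron_def tensor_def forall_4 sum_4 sum_2 algebra_simps)

lemma bounded_bilinear_tensor: "bounded_bilinear tensor"
  unfolding bilinear_conv_bounded_bilinear[symmetric] bilinear_def
  by (auto intro!: linearI simp: tensor_def vec_eq_iff algebra_simps)

text \<open>The sum of the squares of all products of coordinates factors. The equality gives upper
  bounds for products of solutions and also the lower bound needed in (iii).\<close>

lemma norm_tensor: "norm (tensor v w) = norm v * norm w"
proof -
  have "(norm (tensor v w))\<^sup>2 = (norm v * norm w)\<^sup>2"
    by (simp add: power_mult_distrib flip: dot_square_norm)
       (simp add: inner_vec_def tensor_def sum_4 sum_2 algebra_simps)
  then show ?thesis by simp
qed

lemma tensor_decomposition:
  "x = (\<Sum>k\<in>UNIV. x $ k *\<^sub>R tensor (axis (kron_fst k) 1) (axis (kron_snd k) 1))"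
  by (simp add: vec_eq_iff forall_4 sum_4 tensor_def axis_def)

text \<open>The inner product of matrices is the entrywise (Frobenius) one. That it factors makes
  the two Kronecker summands separable by orthogonality.\<close>

lemma inner_kron: "kron P Q \<bullet> kron P' Q' = (P \<bullet> P') * (Q \<bullet> Q')"
  by (simp add: inner_vec_def kron_def sum_4 sum_2 algebra_simps)

lemma kron_add_left: "kron (P + P') Q = kron P Q + kron P' Q"
  and kron_add_right: "kron P (Q + Q') = kron P Q + kron P Q'"
  and kron_scaleR_left: "kron (c *\<^sub>R P) Q = c *\<^sub>R kron P Q"
  and kron_scaleR_right: "kron P (c *\<^sub>R Q) = c *\<^sub>R kron P Q"
  by (simp_all add: kron_def vec_eq_iff algebra_simps)

text \<open>The generator of the tensor product of the flows of \<open>P\<close> and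
  \<open>\<alpha> *\<^sub>R Q\<close>; its action on elementary tensors is the Leibniz rule.\<close>

definition kron_sum :: "real \<Rightarrow> real^2^2 \<Rightarrow> real^2^2 \<Rightarrow> real^4^4" where
  "kron_sum \<alpha> P Q = kron P (mat 1) + \<alpha> *\<^sub>R kron (mat 1) Q"

lemma kron_sum_mult_tensor:
  "kron_sum \<alpha> P Q *v tensor v w = tensor (P *v v) w + tensor v ((\<alpha> *\<^sub>R Q) *v w)"
  by (simp add: kron_sum_def matrix_vector_mult_add_rdistrib kron_mult_tensor matrix_vector_mul_lid
      flip: kron_scaleR_right)

lemma mix_affine: "mix A0 A1 u = A0 + u *\<^sub>R (A1 - A0)"
  by (simp add: mix_def algebra_simps)

lemma kron_sum_mix_affine:
  "kron_sum \<alpha> (mix A0 A1 u) (mix A0 A1 v)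
    = kron_sum \<alpha> A0 A0 + (u *\<^sub>R kron (A1 - A0) (mat 1) + v *\<^sub>R \<alpha> *\<^sub>R kron (mat 1) (A1 - A0))"
  unfolding kron_sum_def mix_affine kron_add_left kron_add_right kron_scaleR_left kron_scaleR_right
  by (simp add: scaleR_add_right mult.commute)

text \<open>The matrix depends affinely on \<open>(u, v)\<close>, so the image of the unit square is
  convex; it contains the four generators as the images of the corners.\<close>

lemma convex_hull_kron_sums:
  assumes "B \<in> convex hull {kron_sum \<alpha> A0 A0, kron_sum \<alpha> A1 A0, kron_sum \<alpha> A0 A1, kron_sum \<alpha> A1 A1}"
  obtains u v where "u \<in> {0..1}" "v \<in> {0..1}" "B = kron_sum \<alpha> (mix A0 A1 u) (mix A0 A1 v)"
proof -
  define f where "f z = kron_sum \<alpha> A0 A0 + (fst z *\<^sub>R kron (A1 - A0) (mat 1) + snd z *\<^sub>R \<alpha> *\<^sub>R kron (mat 1) (A1 - A0))"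
    for z :: "real \<times> real"
  have f: "f (u, v) = kron_sum \<alpha> (mix A0 A1 u) (mix A0 A1 v)" for u v
    by (simp add: f_def kron_sum_mix_affine)
  have mix01: "mix A0 A1 0 = A0" "mix A0 A1 1 = A1" by (simp_all add: mix_def)
  have "f ` ({0..1} \<times> {0..1}) = (+) (kron_sum \<alpha> A0 A0) ` (\<lambda>z. fst z *\<^sub>R kron (A1 - A0) (mat 1) + snd z *\<^sub>R \<alpha> *\<^sub>R kron (mat 1) (A1 - A0)) ` ({0..1} \<times> {0..1})"
    unfolding image_image f_def ..
  moreover have "convex \<dots>"
    by (intro convex_translation convex_linear_image convex_Times linearI) (auto simp: algebra_simps)
  ultimately have "convex (f ` ({0..1} \<times> {0..1}))" by metis
  moreover have "{kron_sum \<alpha> A0 A0, kron_sum \<alpha> A1 A0, kron_sum \<alpha> A0 A1, kron_sum \<alpha> A1 A1} \<subseteq> f ` ({0..1} \<times> {0..1})"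
    using f[of 0 0] f[of 1 0] f[of 0 1] f[of 1 1] unfolding mix01
    by (auto intro!: image_eqI[where f=f, OF sym])
  ultimately have "B \<in> f ` ({0..1} \<times> {0..1})" using assms hull_minimal[of _ _ convex] by blast
  then show thesis using that f by auto
qed

text \<open>
  The coordinates \<open>u\<close>, \<open>v\<close> of a matrix in the hull are read off by the traceless part \<open>N\<close> of
  \<open>A1 - A0\<close>: the matrices \<open>N \<otimes> I\<close> and \<open>I \<otimes> N\<close> are orthogonal to \<open>I \<otimes> (A1 - A0)\<close>
  and \<open>(A1 - A0) \<otimes> I\<close>, respectively.
\<close>

lemma kron_sum_coordinates:
  assumes indep: "independent {mat 1, A0, A1 :: real^2^2}" and dist: "distinct [mat 1, A0, A1]" and "\<alpha> \<noteq> 0"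
  obtains c1 c2 :: "real^4^4" where
    "\<And>u v. c1 \<bullet> (kron_sum \<alpha> (mix A0 A1 u) (mix A0 A1 v) - kron_sum \<alpha> A0 A0) = u"
    "\<And>u v. c2 \<bullet> (kron_sum \<alpha> (mix A0 A1 u) (mix A0 A1 v) - kron_sum \<alpha> A0 A0) = v"
proof -
  define D where "D = A1 - A0"
  define I where "I = (mat 1 :: real^2^2)"
  \<comment> \<open>\<open>I \<bullet> D\<close> is the trace of \<open>D\<close> and
    \<open>I \<bullet> I\<close> is 2, so this projects \<open>D\<close> orthogonally off the scalar
    matrices.\<close>
  define N where "N = D - ((I \<bullet> D) / 2) *\<^sub>R I"
  have II: "I \<bullet> I = 2" by (simp add: I_def inner_vec_def mat_def sum_2)
  have NI: "N \<bullet> I = 0" 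
    unfolding N_def inner_diff_left inner_scaleR_left II by (simp add: inner_commute)
  have ND: "N \<bullet> D = N \<bullet> N"
  proof -
    have "D = N + ((I \<bullet> D) / 2) *\<^sub>R I" by (simp add: N_def)
    then have "N \<bullet> D = N \<bullet> N + ((I \<bullet> D) / 2) * (N \<bullet> I)" by (metis inner_add_right inner_scaleR_right)
    then show ?thesis using NI by simp
  qed
  have "N \<noteq> 0"
  proof
    assume "N = 0"
    then have "A1 = A0 + ((I \<bullet> D) / 2) *\<^sub>R I" by (simp add: N_def D_def algebra_simps)
    then have "A1 \<in> span {mat 1, A0}"
      unfolding I_def by (metis insertI1 insertI2 span_add span_base span_scale)
    moreover have "{mat 1, A0, A1} - {A1} = {mat 1, A0}" using dist by auto
    ultimately show False using indep by (metis dependent_def insertI1 insertI2)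
  qed
  then have NN: "N \<bullet> N \<noteq> 0" by simp
  have eq: "kron_sum \<alpha> (mix A0 A1 u) (mix A0 A1 v) - kron_sum \<alpha> A0 A0 = u *\<^sub>R kron D I + v *\<^sub>R \<alpha> *\<^sub>R kron I D" for u v
    by (simp add: kron_sum_mix_affine D_def I_def)
  show thesis
  proof
    \<comment> \<open>\<open>kron N I \<bullet> kron D I\<close> equals
      \<open>(N \<bullet> D) * (I \<bullet> I)\<close>, which is \<open>2 * (N \<bullet> N)\<close>;
      the other functional has to remove a factor \<alpha> as well.\<close>
    show "((1 / (2 * (N \<bullet> N))) *\<^sub>R kron N I) \<bullet> (kron_sum \<alpha> (mix A0 A1 u) (mix A0 A1 v) - kron_sum \<alpha> A0 A0) = u" for u v
      unfolding eq using NN by (simp add: inner_add_right inner_kron ND NI II)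
    show "((1 / (2 * \<alpha> * (N \<bullet> N))) *\<^sub>R kron I N) \<bullet> (kron_sum \<alpha> (mix A0 A1 u) (mix A0 A1 v) - kron_sum \<alpha> A0 A0) = v" for u v
      unfolding eq using NN \<open>\<alpha> \<noteq> 0\<close> by (simp add: inner_add_right inner_kron ND NI II inner_commute[of I N])
  qed
qed

section \<open>The square wave\<close>

lemma square_wave_add_multiple:
  assumes "0 \<le> s" "s < T"
  shows "square_wave T0 T (s + of_int n * T) = (if s < T0 then 0 else 1)"
proof -
  have "T > 0" using assms by simp
  have "frac ((s + of_int n * T) / T) = frac (s / T + of_int n)"
    using \<open>T > 0\<close> by (simp add: add_divide_distrib)
  also have "\<dots> = s / T" using assms by (simp add: frac_eq)
  finally show ?thesis using \<open>T > 0\<close> by (simp add: square_wave_def)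
qed

text \<open>If \<open>P\<close> left a remainder \<open>r\<close> strictly between 0 and
  \<open>T\<close>, then some interval of phases below \<open>T0\<close> would be moved by
  \<open>r\<close> into the phases from \<open>T0\<close> to \<open>T\<close>. There the wave and
  its translate differ, and an interval is not a null set.\<close>

lemma square_wave_ae_period:
  assumes T: "0 < T0" "T0 < T" and "P > 0"
    and per: "AE t in lebesgue. t \<ge> 0 \<longrightarrow> square_wave T0 T (t + P + t0) = square_wave T0 T (t + t0)"
  obtains k :: int where "P = of_int k * T" "k > 0"
proof -
  define k where "k = \<lfloor>P / T\<rfloor>"
  define r where "r = P - of_int k * T"
  have "T > 0" using T by simp
  have r: "0 \<le> r" "r < T"
    using floor_divide_lower[OF \<open>T > 0\<close>, of P] floor_divide_upper[OF \<open>T > 0\<close>, of P]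
    by (simp_all add: r_def k_def algebra_simps)
  have "r = 0"
  proof (rule ccontr)
    assume "r \<noteq> 0"
    \<comment> \<open>For \<open>s\<close> between \<open>lo\<close> and \<open>hi\<close>, the
      phase \<open>s\<close> is in \<open>[0,T0)\<close> and \<open>s + r\<close> is in
      \<open>[T0,T)\<close>. All four comparisons behind \<open>lo < hi\<close> hold because
      \<open>r\<close> is positive and below \<open>T\<close>.\<close>
    define lo where "lo = max 0 (T0 - r)"
    define hi where "hi = min T0 (T - r)"
    have "lo < hi" using T r \<open>r \<noteq> 0\<close> by (auto simp: lo_def hi_def)
    \<comment> \<open>Shifting by \<open>n\<close> periods makes all the bad times nonnegative,
      where the hypothesis applies.\<close>
    define n where "n = \<lceil>t0 / T\<rceil>"
    have n: "of_int n * T \<ge> t0" using ceiling_divide_upper[OF \<open>T > 0\<close>, of t0] by (simp add: n_def)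
    have bad: "square_wave T0 T (t + P + t0) \<noteq> square_wave T0 T (t + t0)" "t \<ge> 0"
      if "t \<in> {lo + of_int n * T - t0<..<hi + of_int n * T - t0}" for t
    proof -
      define s where "s = t + t0 - of_int n * T"
      have s: "lo < s" "s < hi" using that by (auto simp: s_def)
      have "t + P + t0 = (s + r) + of_int (n + k) * T" "t + t0 = s + of_int n * T"
        by (simp_all add: s_def r_def algebra_simps)
      then show "square_wave T0 T (t + P + t0) \<noteq> square_wave T0 T (t + t0)"
        using square_wave_add_multiple[of "s + r" T T0 "n + k"] square_wave_add_multiple[of s T T0 n] s r T by (simp add: lo_def hi_def)
      show "t \<ge> 0" using s(1) n by (simp add: s_def lo_def)
    qed
    have "AE t in lebesgue. t \<notin> {lo + of_int n * T - t0<..<hi + of_int n * T - t0}"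
      using per by eventually_elim (use bad in blast)
    then have "negligible {lo + of_int n * T - t0<..<hi + of_int n * T - t0}"
      by (simp add: AE_iff_null_sets negligible_iff_null_sets)
    then show False
      using open_not_negligible[of "{lo + of_int n * T - t0<..<hi + of_int n * T - t0}"] \<open>lo < hi\<close> by simp
  qed
  then have "P = of_int k * T" by (simp add: r_def)
  moreover have "k > 0" using calculation \<open>P > 0\<close> \<open>T > 0\<close> by (simp add: zero_less_mult_iff)
  ultimately show thesis by (rule that)
qed

lemma piecewise_constant_square_wave:
  assumes T: "0 < T0" "T0 < T" and "c > 0"
  shows "piecewise_constant (\<lambda>t. square_wave T0 T (c * t + t0))"
  unfolding piecewise_constant_def
proof (intro allI impI)
  fix b :: real assume "b \<ge> 0"
  \<comment> \<open>The indices of the cells met by times in \<open>{0..b}\<close>, and one more: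
    the right end of the last cell is a switching time that must also belong to
    \<open>S\<close>.\<close>
  define J where "J = {\<lfloor>t0 / T\<rfloor>..\<lfloor>(c * b + t0) / T\<rfloor> + 1}"
  define S where "S = (\<lambda>n. (of_int n * T - t0) / c) ` J \<union> (\<lambda>n. (of_int n * T + T0 - t0) / c) ` J"
  have "(\<lambda>t. square_wave T0 T (c * t + t0)) constant_on {s..t}" if st: "{s..t} \<subseteq> {0..b} - S" for s t
  proof (cases "s \<le> t")
    case False
    then show ?thesis by (simp add: constant_on_def)
  next
    case True
    have "s \<in> {0..b} - S" using st True by auto
    define n where "n = \<lfloor>(c * s + t0) / T\<rfloor>"
    have n: "of_int n * T \<le> c * s + t0" "c * s + t0 < (of_int n + 1) * T"
      unfolding n_def using T by (intro floor_divide_lower floor_divide_upper; simp)+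
    have "t0 / T \<le> (c * s + t0) / T" "(c * s + t0) / T \<le> (c * b + t0) / T"
      using T \<open>s \<in> {0..b} - S\<close> \<open>c > 0\<close> by (auto intro!: divide_right_mono)
    then have "n \<in> J" "n + 1 \<in> J" unfolding J_def n_def by (auto intro: floor_mono le_SucI dest: floor_mono)
    then have S: "(of_int n * T + T0 - t0) / c \<in> S" "(of_int (n + 1) * T - t0) / c \<in> S"
      unfolding S_def by blast+
    \<comment> \<open>An interval that avoids the break points and starts before one of them also
      ends before it.\<close>
    have before: "c * t + t0 < p" if "c * s + t0 < p" "(p - t0) / c \<in> S" for p
    proof (rule ccontr)
      assume "\<not> c * t + t0 < p"
      then have "(p - t0) / c \<in> {s..t}" using that(1) \<open>c > 0\<close> by (simp add: field_simps)
      then show False using st that(2) by blast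
    qed
    have wave: "square_wave T0 T (c * r + t0) = (if c * r + t0 < of_int n * T + T0 then 0 else 1)"
      if r: "r \<in> {s..t}" for r
    proof -
      have "c * s \<le> c * r" "c * r \<le> c * t" using r \<open>c > 0\<close> by auto
      moreover have "c * t + t0 < of_int (n + 1) * T" using n S by (intro before) auto
      ultimately show ?thesis
        using square_wave_add_multiple[of "c * r + t0 - of_int n * T" T T0 n] n
        by (auto simp: algebra_simps)
    qed
    show ?thesis
    proof (cases "c * s + t0 < of_int n * T + T0")
      case True
      then have "c * t + t0 < of_int n * T + T0" using S by (intro before) (auto simp: algebra_simps)
      moreover have "c * r \<le> c * t" if "r \<in> {s..t}" for r using that \<open>c > 0\<close> by auto
      ultimately have "square_wave T0 T (c * r + t0) = 0" if "r \<in> {s..t}" for r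
        using wave[OF that] that by (smt (verit))
      then show ?thesis by (auto simp: constant_on_def)
    next
      case False
      moreover have "c * s \<le> c * r" if "r \<in> {s..t}" for r using that \<open>c > 0\<close> by auto
      ultimately have "square_wave T0 T (c * r + t0) = 1" if "r \<in> {s..t}" for r
        using wave[OF that] that by (smt (verit))
      then show ?thesis by (auto simp: constant_on_def)
    qed
  qed
  then show "\<exists>S. finite S \<and> (\<forall>s t. {s..t} \<subseteq> {0..b} - S \<longrightarrow> (\<lambda>t. square_wave T0 T (c * t + t0)) constant_on {s..t})"
    by (intro exI[of _ S]) (auto simp: S_def J_def)
qed

lemma piecewise_constant_combine:
  assumes "piecewise_constant f" "piecewise_constant g"
  shows "piecewise_constant (\<lambda>t. h (f t) (g t))"
  unfolding piecewise_constant_def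
proof (intro allI impI)
  fix b :: real assume "b \<ge> 0"
  obtain S where S: "finite S" "\<And>s t. {s..t} \<subseteq> {0..b} - S \<Longrightarrow> f constant_on {s..t}"
    using assms(1) \<open>b \<ge> 0\<close> unfolding piecewise_constant_def by blast
  obtain S' where S': "finite S'" "\<And>s t. {s..t} \<subseteq> {0..b} - S' \<Longrightarrow> g constant_on {s..t}"
    using assms(2) \<open>b \<ge> 0\<close> unfolding piecewise_constant_def by blast
  show "\<exists>S. finite S \<and> (\<forall>s t. {s..t} \<subseteq> {0..b} - S \<longrightarrow> (\<lambda>t. h (f t) (g t)) constant_on {s..t})"
  proof (intro exI[of _ "S \<union> S'"] conjI allI impI)
    show "finite (S \<union> S')" using S S' by simp
    fix s t assume "{s..t} \<subseteq> {0..b} - (S \<union> S')"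
    then have "f constant_on {s..t}" "g constant_on {s..t}" using S(2)[of s t] S'(2)[of s t] by auto
    then show "(\<lambda>t. h (f t) (g t)) constant_on {s..t}" unfolding constant_on_def by metis
  qed
qed

section \<open>Products of planar solutions\<close>

lemma caratheodory_solution_tensor:
  assumes x: "caratheodory_solution P x" and y: "caratheodory_solution (\<lambda>t. \<alpha> *\<^sub>R Q t) y"
  shows "caratheodory_solution (\<lambda>t. kron_sum \<alpha> (P t) (Q t)) (\<lambda>t. tensor (x t) (y t))"
proof -
  obtain N where N: "negligible N" "\<And>s. s \<ge> 0 \<Longrightarrow> s \<notin> N \<Longrightarrow> (x has_vector_derivative P s *v x s) (at s within {0..})"
    and acx: "\<And>b. b \<ge> 0 \<Longrightarrow> absolutely_continuous_on {0..b} x"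
    by (rule caratheodory_solutionE[OF x]) (rule that)
  obtain N' where N': "negligible N'" "\<And>s. s \<ge> 0 \<Longrightarrow> s \<notin> N' \<Longrightarrow> (y has_vector_derivative (\<alpha> *\<^sub>R Q s) *v y s) (at s within {0..})"
    and acy: "\<And>b. b \<ge> 0 \<Longrightarrow> absolutely_continuous_on {0..b} y"
    by (rule caratheodory_solutionE[OF y]) (rule that)
  show ?thesis
  proof (rule caratheodory_solutionI)
    show "negligible (N \<union> N')" using N N' by simp
    show "((\<lambda>t. tensor (x t) (y t)) has_vector_derivative kron_sum \<alpha> (P t) (Q t) *v tensor (x t) (y t)) (at t within {0..})"
      if "t \<ge> 0" "t \<notin> N \<union> N'" for t
      using bounded_bilinear.has_vector_derivative[OF bounded_bilinear_tensor N(2)[of t] N'(2)[of t]] that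
      by (simp add: kron_sum_mult_tensor add.commute)
    show "absolutely_continuous_on {0..b} (\<lambda>t. tensor (x t) (y t))" if "b \<ge> 0" for b
      using bounded_bilinear_tensor acx[OF that] acy[OF that] by (rule bounded_bilinear_absolutely_continuous_on)
  qed
qed

section \<open>Representation by pairs of planar controls\<close>

lemma mix_uniform_bound:
  fixes A0 A1 :: "real^'n^'n"
  obtains L where "L > 0" "\<And>u y. u \<in> {0..1} \<Longrightarrow> norm (mix A0 A1 u *v y) \<le> L * norm y"
proof -
  have comp: "compact (mix A0 A1 ` {0..1})"
    unfolding mix_def by (intro compact_continuous_image continuous_intros) simp
  obtain L where "L > 0" "\<And>A y. A \<in> mix A0 A1 ` {0..1} \<Longrightarrow> norm (A *v y) \<le> L * norm y"
    by (rule bounded_matrices_uniform_bound[OF compact_imp_bounded[OF comp]]) (rule that)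
  then show thesis using that by blast
qed

lemma kron_sum_uniform_bound:
  obtains L where "L > 0" "\<And>u v y. u \<in> {0..1} \<Longrightarrow> v \<in> {0..1} \<Longrightarrow>
    norm (kron_sum \<alpha> (mix A0 A1 u) (mix A0 A1 v) *v y) \<le> L * norm y"
proof -
  have comp: "compact ((\<lambda>z. kron_sum \<alpha> (mix A0 A1 (fst z)) (mix A0 A1 (snd z))) ` ({0..1} \<times> {0..1}))"
    unfolding kron_sum_mix_affine by (intro compact_continuous_image continuous_intros compact_Times) auto
  obtain L where L: "L > 0" "\<And>A y. A \<in> (\<lambda>z. kron_sum \<alpha> (mix A0 A1 (fst z)) (mix A0 A1 (snd z))) ` ({0..1} \<times> {0..1})
      \<Longrightarrow> norm (A *v y) \<le> L * norm y"
    by (rule bounded_matrices_uniform_bound[OF compact_imp_bounded[OF comp]]) (rule that)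
  show thesis
  proof (rule that[OF L(1)])
    fix u v :: real and y assume "u \<in> {0..1}" "v \<in> {0..1}"
    then show "norm (kron_sum \<alpha> (mix A0 A1 u) (mix A0 A1 v) *v y) \<le> L * norm y"
      by (intro L(2) image_eqI[of _ _ "(u, v)"]) auto
  qed
qed

lemma switched_solution_exists:
  assumes "control u"
  obtains x where "switched_solution A0 A1 u x" "x 0 = w"
proof -
  obtain L where L: "L > 0" "\<And>u y. u \<in> {0..1} \<Longrightarrow> norm (mix A0 A1 u *v y) \<le> L * norm y"
    by (rule mix_uniform_bound[of A0 A1]) (rule that)
  have "u \<in> borel_measurable (lebesgue_on {0..})"
    using assms by (simp add: control_def measurable_halfline_def)
  then have meas: "measurable_halfline (\<lambda>t. mix A0 A1 (u t))"
    unfolding measurable_halfline_def mix_def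
    by (intro borel_measurable_scaleR borel_measurable_add borel_measurable_diff borel_measurable_const)
  show thesis
  proof (rule caratheodory_solution_exists[OF meas L(1)])
    show "norm (mix A0 A1 (u t) *v y) \<le> L * norm y" if "t \<ge> 0" for t y
      using assms that by (intro L(2)) (auto simp: control_def)
  qed (rule that)
qed

text \<open>At time 0 the four products are the basis tensors, so the combination with the
  coordinates of \<open>x 0\<close> as coefficients has the same initial value as \<open>x\<close>,
  and uniqueness identifies the two.\<close>

lemma kron_sum_solution_representation:
  assumes u: "control u" and v: "control v" and "\<alpha> > 0"
  obtains \<phi> \<psi> :: "2 \<Rightarrow> real \<Rightarrow> real^2" where
    "\<And>i. switched_solution A0 A1 u (\<phi> i)" "\<And>i. \<phi> i 0 = axis i 1"
    "\<And>j. switched_solution A0 A1 v (\<psi> j)" "\<And>j. \<psi> j 0 = axis j 1"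
    "\<And>x t. caratheodory_solution (\<lambda>t. kron_sum \<alpha> (mix A0 A1 (u t)) (mix A0 A1 (v (\<alpha> * t)))) x \<Longrightarrow> t \<ge> 0 \<Longrightarrow>
        x t = (\<Sum>k\<in>UNIV. x 0 $ k *\<^sub>R tensor (\<phi> (kron_fst k) t) (\<psi> (kron_snd k) (\<alpha> * t)))"
proof -
  let ?B = "\<lambda>t. kron_sum \<alpha> (mix A0 A1 (u t)) (mix A0 A1 (v (\<alpha> * t)))"
  have "\<exists>x. switched_solution A0 A1 u x \<and> x 0 = axis i 1" for i
    using switched_solution_exists[OF u] by metis
  then obtain \<phi> :: "2 \<Rightarrow> real \<Rightarrow> real^2" where \<phi>: "\<And>i. switched_solution A0 A1 u (\<phi> i)" "\<And>i. \<phi> i 0 = axis i 1"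
    by metis
  have "\<exists>x. switched_solution A0 A1 v x \<and> x 0 = axis i 1" for i
    using switched_solution_exists[OF v] by metis
  then obtain \<psi> :: "2 \<Rightarrow> real \<Rightarrow> real^2" where \<psi>: "\<And>i. switched_solution A0 A1 v (\<psi> i)" "\<And>i. \<psi> i 0 = axis i 1"
    by metis
  obtain L where L: "L > 0" "\<And>u v y. u \<in> {0..1} \<Longrightarrow> v \<in> {0..1} \<Longrightarrow>
      norm (kron_sum \<alpha> (mix A0 A1 u) (mix A0 A1 v) *v y) \<le> L * norm y"
    by (rule kron_sum_uniform_bound[of \<alpha> A0 A1]) (rule that)
  show thesis
  proof (rule that[OF \<phi> \<psi>])
    fix x and t :: real assume x: "caratheodory_solution ?B x" and "t \<ge> 0"
    let ?y = "\<lambda>t. \<Sum>k\<in>UNIV. x 0 $ k *\<^sub>R tensor (\<phi> (kron_fst k) t) (\<psi> (kron_snd k) (\<alpha> * t))"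
    have y: "caratheodory_solution ?B ?y"
      by (intro caratheodory_solution_sum caratheodory_solution_scaleR caratheodory_solution_tensor
          caratheodory_solution_scale \<phi> \<psi> \<open>\<alpha> > 0\<close>) simp
    show "x t = ?y t"
    proof (rule caratheodory_solution_unique[OF _ x y _ order_refl \<open>t \<ge> 0\<close>])
      show "norm (?B s *v z) \<le> L * norm z" if "s \<ge> 0" for s z
        using u v that \<open>\<alpha> > 0\<close> by (intro L(2)) (auto simp: control_def)
      show "x 0 = ?y 0" using tensor_decomposition[of "x 0"] by (simp add: \<phi> \<psi>)
    qed
  qed
qed

lemma norm_tensor_sum_le:
  assumes "\<And>i. norm (p i) \<le> a" "\<And>j. norm (q j) \<le> b"
  shows "norm (\<Sum>k\<in>UNIV. x $ k *\<^sub>R tensor (p (kron_fst k)) (q (kron_snd k))) \<le> 4 * (a * b) * norm x"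
proof -
  have "a \<ge> 0" using order_trans[OF norm_ge_zero assms(1)] .
  have "norm (\<Sum>k\<in>UNIV. x $ k *\<^sub>R tensor (p (kron_fst k)) (q (kron_snd k))) \<le> (\<Sum>k\<in>(UNIV :: 4 set). norm x * (a * b))"
  proof (rule sum_norm_le)
    fix k :: 4
    have "\<bar>x $ k\<bar> * (norm (p (kron_fst k)) * norm (q (kron_snd k))) \<le> norm x * (a * b)"
      using assms \<open>a \<ge> 0\<close> by (intro mult_mono component_le_norm_cart) auto
    then show "norm (x $ k *\<^sub>R tensor (p (kron_fst k)) (q (kron_snd k))) \<le> norm x * (a * b)"
      by (simp add: norm_tensor)
  qed
  then show ?thesis by (simp add: algebra_simps)
qed

text \<open>The controls are affine functions of \<open>B t\<close>, so measurability and every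
  exact period carry over. Since \<open>v\<close> is read at time \<open>\<alpha> * t\<close>, its
  definition runs \<open>B\<close> on the inverse clock and its period is
  \<open>\<alpha> * P\<close>.\<close>

lemma hull_control_decomposition:
  assumes adm: "admissible_a A0 A1" and "\<alpha> > 0" and meas: "measurable_halfline B"
    and B: "\<And>t. t \<ge> 0 \<Longrightarrow> B t \<in> convex hull {kron_sum \<alpha> A0 A0, kron_sum \<alpha> A1 A0, kron_sum \<alpha> A0 A1, kron_sum \<alpha> A1 A1}"
  obtains u v where "control u" "control v"
    "\<And>t. t \<ge> 0 \<Longrightarrow> B t = kron_sum \<alpha> (mix A0 A1 (u t)) (mix A0 A1 (v (\<alpha> * t)))"
    "\<And>P. has_period B P \<Longrightarrow> has_period u P \<and> has_period v (\<alpha> * P)"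
proof -
  obtain c1 c2 where
    c1: "\<And>u v. c1 \<bullet> (kron_sum \<alpha> (mix A0 A1 u) (mix A0 A1 v) - kron_sum \<alpha> A0 A0) = u" and
    c2: "\<And>u v. c2 \<bullet> (kron_sum \<alpha> (mix A0 A1 u) (mix A0 A1 v) - kron_sum \<alpha> A0 A0) = v"
    using kron_sum_coordinates[of A0 A1 \<alpha>] adm \<open>\<alpha> > 0\<close> unfolding admissible_a_def by (metis less_irrefl)
  define u where "u t = c1 \<bullet> (B t - kron_sum \<alpha> A0 A0)" for t
  define v where "v t = c2 \<bullet> (B (inverse \<alpha> * t) - kron_sum \<alpha> A0 A0)" for t
  have inv: "inverse \<alpha> * (\<alpha> * t) = t" "\<alpha> * (inverse \<alpha> * t) = t" for t
    using \<open>\<alpha> > 0\<close> by (simp_all flip: mult.assoc)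
  have uv: "u t \<in> {0..1} \<and> v (\<alpha> * t) \<in> {0..1} \<and> B t = kron_sum \<alpha> (mix A0 A1 (u t)) (mix A0 A1 (v (\<alpha> * t)))" if "t \<ge> 0" for t
  proof -
    obtain p q where pq: "p \<in> {0..1}" "q \<in> {0..1}" "B t = kron_sum \<alpha> (mix A0 A1 p) (mix A0 A1 q)"
      by (rule convex_hull_kron_sums[OF B[OF \<open>t \<ge> 0\<close>]]) (rule that)
    have "u t = p" "v (\<alpha> * t) = q" using c1 c2 pq(3) \<open>\<alpha> > 0\<close> by (simp_all add: u_def v_def inv)
    then show ?thesis using pq by simp
  qed
  have v01: "v t \<in> {0..1}" if "t \<ge> 0" for t
    using uv[of "inverse \<alpha> * t"] that \<open>\<alpha> > 0\<close> unfolding inv by simp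
  have mu: "measurable_halfline u"
    using meas unfolding u_def measurable_halfline_def by (intro borel_measurable_inner borel_measurable_diff) auto
  have "measurable_halfline (\<lambda>t. B (inverse \<alpha> * t))"
    using meas \<open>\<alpha> > 0\<close> by (intro measurable_halfline_scale) auto
  then have mv: "measurable_halfline v"
    unfolding v_def measurable_halfline_def by (intro borel_measurable_inner borel_measurable_diff) auto
  show thesis
  proof (rule that)
    show "control u" "control v" using mu mv uv v01 by (auto simp: control_def)
    show "B t = kron_sum \<alpha> (mix A0 A1 (u t)) (mix A0 A1 (v (\<alpha> * t)))" if "t \<ge> 0" for t
      using uv[OF that] by blast
    fix P assume P: "has_period B P"
    have "inverse \<alpha> * (t + \<alpha> * P) = inverse \<alpha> * t + P" for t
      by (simp add: distrib_left inv)
    then show "has_period u P \<and> has_period v (\<alpha> * P)"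
      using P \<open>\<alpha> > 0\<close> by (simp add: has_period_def u_def v_def)
  qed
qed

section \<open>Boundedness, and decay under periodic switching\<close>

lemma AE_lebesgue_translate:
  assumes "AE t in lebesgue. t \<ge> 0 \<longrightarrow> Q t" and "P \<ge> (0::real)"
  shows "AE t in lebesgue. t \<ge> 0 \<longrightarrow> Q (t + P)"
proof -
  obtain N where N: "negligible N" "\<And>t. t \<notin> N \<Longrightarrow> t \<ge> 0 \<longrightarrow> Q t"
    by (rule AE_lebesgue_negligibleE[OF assms(1)]) (rule that)
  have "negligible ((+) (- P) ` N)" using N(1) by (rule negligible_translation)
  moreover have "Q (t + P)" if "t \<notin> (+) (- P) ` N" "t \<ge> 0" for t
  proof -
    have "t + P \<notin> N" using that(1) by (metis add.commute add_diff_cancel_right' diff_conv_add_uminus image_eqI)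
    then show ?thesis using N(2) that(2) assms(2) by simp
  qed
  ultimately show ?thesis by (intro AE_I'[of "(+) (- P) ` N"]) (auto simp: negligible_iff_null_sets)
qed

text \<open>Without exponential decay, (d) makes \<open>u\<close> a shifted square wave almost
  everywhere. The given period \<open>P\<close> is then an almost everywhere period of that wave,
  hence a multiple of \<open>T\<close>.\<close>

lemma admissible_d_dichotomy:
  assumes d: "admissible_d A0 A1 T0 T" and T: "0 < T0" "T0 < T"
    and u: "control u" "has_period u P"
  shows "(\<forall>x. switched_solution A0 A1 u x \<longrightarrow> converges_exponentially_to_0 x) \<or> (\<exists>k::int. k > 0 \<and> P = of_int k * T)"
proof (subst disj_commute, rule disjCI)
  assume "\<not> (\<forall>x. switched_solution A0 A1 u x \<longrightarrow> converges_exponentially_to_0 x)"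
  then obtain t0 where t0: "ae_eq u (\<lambda>t. square_wave T0 T (t + t0))"
    using d u unfolding admissible_d_def periodic_def Let_def by blast
  have "P > 0" using u by (simp add: has_period_def)
  have ae: "AE t in lebesgue. t \<ge> 0 \<longrightarrow> u t = square_wave T0 T (t + t0)" using t0 by (simp add: ae_eq_def)
  have "AE t in lebesgue. t \<ge> 0 \<longrightarrow> u (t + P) = square_wave T0 T (t + P + t0)"
    using AE_lebesgue_translate[OF ae] \<open>P > 0\<close> by simp
  with ae have "AE t in lebesgue. t \<ge> 0 \<longrightarrow> square_wave T0 T (t + P + t0) = square_wave T0 T (t + t0)"
    by eventually_elim (use u in \<open>auto simp: has_period_def\<close>)
  then show "\<exists>k::int. k > 0 \<and> P = of_int k * T"
    by (rule square_wave_ae_period[OF T \<open>P > 0\<close>]) blast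
qed

lemma uniform_exponential_bound:
  fixes \<phi> :: "2 \<Rightarrow> real \<Rightarrow> 'a::real_normed_vector"
  assumes "\<And>i. converges_exponentially_to_0 (\<phi> i)"
  obtains M c where "M > 0" "c > 0" "\<And>i t. t \<ge> 0 \<Longrightarrow> norm (\<phi> i t) \<le> M * exp (- (c * t))"
proof -
  obtain M c where Mc: "\<And>i. M i > 0" "\<And>i. c i > 0" "\<And>i t. t \<ge> 0 \<Longrightarrow> norm (\<phi> i t) \<le> M i * exp (- (c i * t))"
    using assms unfolding converges_exponentially_to_0_def by metis
  show thesis
  proof (rule that[of "M 1 + M 2" "min (c 1) (c 2)"])
    show "M 1 + M 2 > 0" "min (c 1) (c 2) > 0" using Mc(1,2) by (auto simp: add_pos_pos)
    fix i t assume "t \<ge> (0::real)"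
    have i: "M i \<le> M 1 + M 2" "min (c 1) (c 2) \<le> c i"
      using exhaust_2[of i] Mc(1)[of 1] Mc(1)[of 2] by auto
    have "norm (\<phi> i t) \<le> M i * exp (- (c i * t))" using Mc(3) \<open>t \<ge> 0\<close> .
    also have "\<dots> \<le> (M 1 + M 2) * exp (- (min (c 1) (c 2) * t))"
      using i \<open>t \<ge> 0\<close> Mc(1)[of i] by (intro mult_mono) (auto intro: mult_right_mono less_imp_le)
    finally show "norm (\<phi> i t) \<le> (M 1 + M 2) * exp (- (min (c 1) (c 2) * t))" .
  qed
qed

lemma kron_sum_bounded:
  assumes C: "C > 0" "\<And>u x t. control u \<Longrightarrow> switched_solution A0 A1 u x \<Longrightarrow> t \<ge> 0 \<Longrightarrow> norm (x t) \<le> C * norm (x 0)"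
    and uv: "control u" "control v" and "\<alpha> > 0"
    and x: "caratheodory_solution (\<lambda>t. kron_sum \<alpha> (mix A0 A1 (u t)) (mix A0 A1 (v (\<alpha> * t)))) x" and "t \<ge> 0"
  shows "norm (x t) \<le> 4 * (C * C) * norm (x 0)"
proof -
  obtain \<phi> \<psi> :: "2 \<Rightarrow> real \<Rightarrow> real^2" where \<phi>: "\<And>i. switched_solution A0 A1 u (\<phi> i)" "\<And>i. \<phi> i 0 = axis i 1"
    and \<psi>: "\<And>j. switched_solution A0 A1 v (\<psi> j)" "\<And>j. \<psi> j 0 = axis j 1"
    and rep: "\<And>x t. caratheodory_solution (\<lambda>t. kron_sum \<alpha> (mix A0 A1 (u t)) (mix A0 A1 (v (\<alpha> * t)))) x \<Longrightarrow> t \<ge> 0 \<Longrightarrow>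
        x t = (\<Sum>k\<in>UNIV. x 0 $ k *\<^sub>R tensor (\<phi> (kron_fst k) t) (\<psi> (kron_snd k) (\<alpha> * t)))"
    by (rule kron_sum_solution_representation[OF uv \<open>\<alpha> > 0\<close>, of A0 A1]) (rule that)
  show ?thesis
    unfolding rep[OF x \<open>t \<ge> 0\<close>]
  proof (rule norm_tensor_sum_le)
    show "norm (\<phi> i t) \<le> C" for i using C(2)[OF uv(1) \<phi>(1) \<open>t \<ge> 0\<close>, of i] by (simp add: \<phi>(2))
    show "norm (\<psi> i (\<alpha> * t)) \<le> C" for i
      using C(2)[OF uv(2) \<psi>(1), of "\<alpha> * t" i] \<open>t \<ge> 0\<close> \<open>\<alpha> > 0\<close> by (simp add: \<psi>(2))
  qed
qed

text \<open>One decaying factor suffices because (b) keeps the other bounded by \<open>C\<close>.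
  Decay of the second factor at rate c becomes rate c \<alpha> in the time \<open>t\<close>.\<close>

lemma kron_sum_converges:
  assumes C: "C > 0" "\<And>u x t. control u \<Longrightarrow> switched_solution A0 A1 u x \<Longrightarrow> t \<ge> 0 \<Longrightarrow> norm (x t) \<le> C * norm (x 0)"
    and uv: "control u" "control v" and "\<alpha> > 0"
    and x: "caratheodory_solution (\<lambda>t. kron_sum \<alpha> (mix A0 A1 (u t)) (mix A0 A1 (v (\<alpha> * t)))) x"
    and exp: "(\<forall>y. switched_solution A0 A1 u y \<longrightarrow> converges_exponentially_to_0 y) \<or>
              (\<forall>y. switched_solution A0 A1 v y \<longrightarrow> converges_exponentially_to_0 y)"
  shows "converges_exponentially_to_0 x"
proof -
  obtain \<phi> \<psi> :: "2 \<Rightarrow> real \<Rightarrow> real^2" where \<phi>: "\<And>i. switched_solution A0 A1 u (\<phi> i)" "\<And>i. \<phi> i 0 = axis i 1"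
    and \<psi>: "\<And>j. switched_solution A0 A1 v (\<psi> j)" "\<And>j. \<psi> j 0 = axis j 1"
    and rep: "\<And>x t. caratheodory_solution (\<lambda>t. kron_sum \<alpha> (mix A0 A1 (u t)) (mix A0 A1 (v (\<alpha> * t)))) x \<Longrightarrow> t \<ge> 0 \<Longrightarrow>
        x t = (\<Sum>k\<in>UNIV. x 0 $ k *\<^sub>R tensor (\<phi> (kron_fst k) t) (\<psi> (kron_snd k) (\<alpha> * t)))"
    by (rule kron_sum_solution_representation[OF uv \<open>\<alpha> > 0\<close>, of A0 A1]) (rule that)
  have C\<phi>: "norm (\<phi> i t) \<le> C" if "t \<ge> 0" for i t using C(2)[OF uv(1) \<phi>(1) that, of i] by (simp add: \<phi>(2))
  have C\<psi>: "norm (\<psi> i (\<alpha> * t)) \<le> C" if "t \<ge> 0" for i t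
    using C(2)[OF uv(2) \<psi>(1), of "\<alpha> * t" i] that \<open>\<alpha> > 0\<close> by (simp add: \<psi>(2))
  have "\<exists>M c. M > 0 \<and> c > 0 \<and> (\<forall>t\<ge>0. norm (x t) \<le> 4 * (M * exp (- (c * t)) * C) * norm (x 0))"
    using exp
  proof
    assume "\<forall>y. switched_solution A0 A1 u y \<longrightarrow> converges_exponentially_to_0 y"
    then obtain M c where M: "M > 0" "c > 0" "\<And>i t. t \<ge> 0 \<Longrightarrow> norm (\<phi> i t) \<le> M * exp (- (c * t))"
      using uniform_exponential_bound[of \<phi>] \<phi>(1) by metis
    have "norm (x t) \<le> 4 * (M * exp (- (c * t)) * C) * norm (x 0)" if "t \<ge> 0" for t
      unfolding rep[OF x that] using M(3)[OF that] C\<psi>[OF that] by (intro norm_tensor_sum_le)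
    then show ?thesis using M by blast
  next
    assume "\<forall>y. switched_solution A0 A1 v y \<longrightarrow> converges_exponentially_to_0 y"
    then obtain M c where M: "M > 0" "c > 0" "\<And>i t. t \<ge> 0 \<Longrightarrow> norm (\<psi> i t) \<le> M * exp (- (c * t))"
      using uniform_exponential_bound[of \<psi>] \<psi>(1) by metis
    have "norm (x t) \<le> 4 * (C * (M * exp (- (c * \<alpha> * t)))) * norm (x 0)" if "t \<ge> 0" for t
      unfolding rep[OF x that] using M(3)[of "\<alpha> * t"] C\<phi>[OF that] that \<open>\<alpha> > 0\<close>
      by (intro norm_tensor_sum_le) (auto simp: mult.assoc)
    then show ?thesis using M \<open>\<alpha> > 0\<close> by (intro exI[of _ M] exI[of _ "c * \<alpha>"]) (simp add: mult_ac)
  qed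
  then obtain M c where M: "M > 0" "c > 0" "\<And>t. t \<ge> 0 \<Longrightarrow> norm (x t) \<le> 4 * (M * exp (- (c * t)) * C) * norm (x 0)"
    by blast
  \<comment> \<open>The summand 1 keeps the constant positive even for the zero solution.\<close>
  define M' where "M' = 4 * (M * C) * norm (x 0) + 1"
  have "M' > 0" using M C(1) by (simp add: M'_def add_nonneg_pos)
  moreover have "norm (x t) \<le> M' * exp (- (c * t))" if "t \<ge> 0" for t
  proof -
    have "norm (x t) \<le> 4 * (M * C) * norm (x 0) * exp (- (c * t))"
      using M(3)[OF that] by (simp add: mult_ac)
    also have "\<dots> \<le> M' * exp (- (c * t))" unfolding M'_def by (intro mult_right_mono) auto
    finally show ?thesis .
  qed
  ultimately show ?thesis using M(2) unfolding converges_exponentially_to_0_def by blast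
qed

section \<open>A trajectory bounded away from the origin\<close>

lemma has_period_add_multiple:
  assumes "has_period f P" "t \<ge> 0"
  shows "f (t + real n * P) = f t"
proof (induction n)
  case (Suc n)
  have "f (t + real (Suc n) * P) = f ((t + real n * P) + P)" by (simp add: algebra_simps)
  also have "\<dots> = f (t + real n * P)" using assms by (simp add: has_period_def)
  finally show ?case using Suc by simp
qed simp

text \<open>A zero at time \<open>s\<close> would persist by uniqueness, in particular up to a later
  multiple of the period, where the value is the nonzero \<open>x 0\<close>. So the norm has a
  positive minimum over one period.\<close>

lemma periodic_switched_solution_bounded_below:
  assumes "control u" and x: "switched_solution A0 A1 u x" and "has_period x P" and "x 0 \<noteq> 0"
  obtains m where "m > 0" "\<And>t. t \<ge> 0 \<Longrightarrow> m \<le> norm (x t)"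
proof -
  have "P > 0" using assms by (simp add: has_period_def)
  obtain L where L: "L > 0" "\<And>u y. u \<in> {0..1} \<Longrightarrow> norm (mix A0 A1 u *v y) \<le> L * norm y"
    by (rule mix_uniform_bound[of A0 A1]) (rule that)
  have zero: "switched_solution A0 A1 u (\<lambda>t. 0)"
    using caratheodory_solution_scaleR[OF x, of 0] by simp
  have nz: "x s \<noteq> 0" if "s \<ge> 0" for s
  proof
    assume "x s = 0"
    obtain n :: nat where "s / P < real n" using reals_Archimedean2 by blast
    then have "s \<le> real n * P" using \<open>P > 0\<close> by (simp add: pos_divide_less_eq)
    have "x (real n * P) = 0"
    proof (rule caratheodory_solution_unique[OF _ x zero \<open>x s = 0\<close> that \<open>s \<le> real n * P\<close>])
      show "norm (mix A0 A1 (u t) *v y) \<le> L * norm y" if "t \<ge> 0" for t y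
        using \<open>control u\<close> that by (intro L(2)) (auto simp: control_def)
    qed
    then show False using has_period_add_multiple[OF \<open>has_period x P\<close>, of 0 n] \<open>x 0 \<noteq> 0\<close> by simp
  qed
  have "continuous_on {0..P} (\<lambda>t. norm (x t))"
    using x \<open>P > 0\<close> by (intro continuous_on_norm absolutely_continuous_on_imp_continuous_on)
      (simp add: caratheodory_solution_def)
  then obtain s where s: "s \<in> {0..P}" "\<And>t. t \<in> {0..P} \<Longrightarrow> norm (x s) \<le> norm (x t)"
    using continuous_attains_inf[of "{0..P}"] \<open>P > 0\<close> by force
  show thesis
  proof (rule that[of "norm (x s)"])
    show "norm (x s) > 0" using nz s(1) by simp
    fix t :: real assume "t \<ge> 0"
    define n where "n = nat \<lfloor>t / P\<rfloor>"
    have n: "real n * P \<le> t" "t < (real n + 1) * P"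
      using \<open>t \<ge> 0\<close> \<open>P > 0\<close> floor_divide_lower[of P t] floor_divide_upper[of P t] by (auto simp: n_def)
    then have "x t = x (t - real n * P)"
      using has_period_add_multiple[OF \<open>has_period x P\<close>, of "t - real n * P" n] by simp
    moreover have "t - real n * P \<in> {0..P}" using n by (auto simp: algebra_simps)
    ultimately show "norm (x s) \<le> norm (x t)" using s(2) by simp
  qed
qed

text \<open>Replaces the control of (c) by the shifted square wave itself, which takes only the
  values 0 and 1 at every time; the switching law of (iii) must lie among the four matrices
  everywhere, not just almost everywhere.\<close>

lemma admissible_c_periodic_solution:
  assumes "admissible_c A0 A1 T0 T"
  obtains t0 x P where "switched_solution A0 A1 (\<lambda>t. square_wave T0 T (t + t0)) x" "x 0 \<noteq> 0" "has_period x P"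
proof -
  have "axis 1 1 \<noteq> (0 :: real^2)" by simp
  then obtain u x t0 where u: "switched_solution A0 A1 u x" "x 0 = axis 1 1" "periodic x"
      "ae_eq u (\<lambda>t. square_wave T0 T (t + t0))"
    using assms unfolding admissible_c_def by meson
  have "AE t in lebesgue. t \<ge> 0 \<longrightarrow> mix A0 A1 (u t) = mix A0 A1 (square_wave T0 T (t + t0))"
    using u(4) unfolding ae_eq_def by eventually_elim auto
  then have "switched_solution A0 A1 (\<lambda>t. square_wave T0 T (t + t0)) x"
    using u(1) by (rule caratheodory_solution_cong_AE)
  then show thesis using that u(2,3) by (metis \<open>axis 1 1 \<noteq> 0\<close> periodic_def)
qed

lemma measurable_square_wave: "(\<lambda>t. square_wave T0 T (t + t0)) \<in> borel_measurable borel"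
  unfolding square_wave_def frac_def by measurable

lemma control_square_wave: "control (\<lambda>t. square_wave T0 T (t + t0))"
proof -
  have "(\<lambda>t. square_wave T0 T (t + t0)) \<in> borel_measurable lebesgue"
    using measurable_square_wave by (simp add: measurable_completion)
  then show ?thesis
    by (auto simp: control_def measurable_halfline_def measurable_restrict_space1 square_wave_def)
qed

text \<open>One planar periodic solution, run on the clocks \<open>t\<close> and
  \<open>\<alpha> * t\<close>, supplies both factors; its lower bound \<open>m\<close> gives
  \<open>m * m\<close> for the product.\<close>

lemma square_wave_switching_not_accumulating:
  assumes c: "admissible_c A0 A1 T0 T" and T: "0 < T0" "T0 < T" and "\<alpha> > 0"
  obtains B x where "piecewise_constant B"
    "\<And>t. B t \<in> {kron_sum \<alpha> A0 A0, kron_sum \<alpha> A1 A0, kron_sum \<alpha> A0 A1, kron_sum \<alpha> A1 A1}"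
    "caratheodory_solution B x" "\<not> accumulates_at_0 x"
proof -
  obtain t0 x P where x: "switched_solution A0 A1 (\<lambda>t. square_wave T0 T (t + t0)) x" "x 0 \<noteq> 0" "has_period x P"
    by (rule admissible_c_periodic_solution[OF c]) (rule that)
  obtain m where m: "m > 0" "\<And>t. t \<ge> 0 \<Longrightarrow> m \<le> norm (x t)"
    by (rule periodic_switched_solution_bounded_below[OF control_square_wave x(1) x(3) x(2)]) (rule that)
  let ?B = "\<lambda>t. kron_sum \<alpha> (mix A0 A1 (square_wave T0 T (t + t0))) (mix A0 A1 (square_wave T0 T (\<alpha> * t + t0)))"
  let ?x = "\<lambda>t. tensor (x t) (x (\<alpha> * t))"
  show thesis
  proof (rule that[of ?B ?x])
    show "piecewise_constant ?B"
      using piecewise_constant_combine[where h = "\<lambda>p q. kron_sum \<alpha> (mix A0 A1 p) (mix A0 A1 q)",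
          OF piecewise_constant_square_wave[OF T zero_less_one] piecewise_constant_square_wave[OF T \<open>\<alpha> > 0\<close>]]
      by simp
    show "?B t \<in> {kron_sum \<alpha> A0 A0, kron_sum \<alpha> A1 A0, kron_sum \<alpha> A0 A1, kron_sum \<alpha> A1 A1}" for t
      by (auto simp: square_wave_def mix_def)
    show "caratheodory_solution ?B ?x"
      using caratheodory_solution_tensor[OF x(1) caratheodory_solution_scale[OF x(1) \<open>\<alpha> > 0\<close>]] .
    have "ereal (m * m) \<le> Liminf at_top (\<lambda>t. ereal (norm (?x t)))"
    proof (rule Liminf_bounded)
      show "\<forall>\<^sub>F t in at_top. ereal (m * m) \<le> ereal (norm (?x t))"
        using eventually_ge_at_top[of 0]
      proof eventually_elim
        case (elim t)
        then show ?case using m \<open>\<alpha> > 0\<close> by (simp add: norm_tensor mult_mono')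
      qed
    qed
    moreover have "0 < ereal (m * m)" using m(1) by simp
    ultimately show "\<not> accumulates_at_0 ?x" unfolding accumulates_at_0_def using less_le_trans by blast
  qed
qed

theorem theorem3:
  fixes A0 A1 :: "real^2^2" and \<alpha> :: real
    and B0 B1 B2 B3 :: "real^4^4" and BB :: "(real^4^4) set"
  assumes "admissible A0 A1"
    and "\<alpha> > 0" and "\<alpha> \<notin> \<rat>"
    and "B0 = kron A0 (mat 1) + \<alpha> *\<^sub>R kron (mat 1) A0"
    and "B1 = kron A1 (mat 1) + \<alpha> *\<^sub>R kron (mat 1) A0"
    and "B2 = kron A0 (mat 1) + \<alpha> *\<^sub>R kron (mat 1) A1"
    and "B3 = kron A1 (mat 1) + \<alpha> *\<^sub>R kron (mat 1) A1"
    and "BB = convex hull {B0, B1, B2, B3}"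
  shows
    "(\<exists>K>0. \<forall>B. measurable_halfline B \<and> (\<forall>t\<ge>0. B t \<in> BB) \<longrightarrow>
        (\<forall>w x. caratheodory_solution B x \<and> x 0 = w \<longrightarrow>
           (\<forall>t\<ge>0. norm (x t) \<le> K * norm (x 0)))) \<and>
     (\<forall>B. measurable_halfline B \<and> (\<forall>t\<ge>0. B t \<in> BB) \<and> periodic B \<longrightarrow>
        (\<forall>x. caratheodory_solution B x \<longrightarrow> converges_exponentially_to_0 x)) \<and>
     (\<exists>B w. piecewise_constant B \<and> (\<forall>t\<ge>0. B t \<in> {B0, B1, B2, B3}) \<and>
        (\<exists>x. caratheodory_solution B x \<and> x 0 = w \<and> \<not> accumulates_at_0 x))"
proof -
  obtain C where C: "C > 0" "\<And>u x t. control u \<Longrightarrow> switched_solution A0 A1 u x \<Longrightarrow> t \<ge> 0 \<Longrightarrow> norm (x t) \<le> C * norm (x 0)"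
    using \<open>admissible A0 A1\<close> unfolding admissible_def admissible_b_def by blast
  obtain T0 T where T: "0 < T0" "T0 < T" and c: "admissible_c A0 A1 T0 T" and d: "admissible_d A0 A1 T0 T"
    and a: "admissible_a A0 A1"
    using \<open>admissible A0 A1\<close> unfolding admissible_def by blast
  note Bs = assms(4-7)[folded kron_sum_def]
  have BB: "BB = convex hull {kron_sum \<alpha> A0 A0, kron_sum \<alpha> A1 A0, kron_sum \<alpha> A0 A1, kron_sum \<alpha> A1 A1}"
    using assms(8) Bs by simp
  \<comment> \<open>Parts (i) and (ii) share one decomposition of \<open>B\<close>; the bound
    depends on \<open>C\<close> alone and is thus uniform in \<open>B\<close>.\<close>
  have main: "(\<forall>t\<ge>0. norm (x t) \<le> 4 * (C * C) * norm (x 0)) \<and> (periodic B \<longrightarrow> converges_exponentially_to_0 x)"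
    if B: "measurable_halfline B" "\<forall>t\<ge>0. B t \<in> BB" and x: "caratheodory_solution B x" for B x
  proof -
    obtain u v where uv: "control u" "control v"
      and Buv: "\<And>t. t \<ge> 0 \<Longrightarrow> B t = kron_sum \<alpha> (mix A0 A1 (u t)) (mix A0 A1 (v (\<alpha> * t)))"
      and per: "\<And>P. has_period B P \<Longrightarrow> has_period u P \<and> has_period v (\<alpha> * P)"
    proof (rule hull_control_decomposition[OF a \<open>\<alpha> > 0\<close> B(1)])
      show "B t \<in> convex hull {kron_sum \<alpha> A0 A0, kron_sum \<alpha> A1 A0, kron_sum \<alpha> A0 A1, kron_sum \<alpha> A1 A1}" if "t \<ge> 0" for t
        using B(2) that BB by blast
    qed (rule that)
    have x': "caratheodory_solution (\<lambda>t. kron_sum \<alpha> (mix A0 A1 (u t)) (mix A0 A1 (v (\<alpha> * t)))) x"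
      using x by (rule caratheodory_solution_cong_AE[rotated]) (simp add: Buv)
    show ?thesis
    proof (intro conjI allI impI)
      show "norm (x t) \<le> 4 * (C * C) * norm (x 0)" if "t \<ge> 0" for t
        by (rule kron_sum_bounded[OF C uv \<open>\<alpha> > 0\<close> x' that])
      assume "periodic B"
      then obtain P where P: "has_period B P" by (auto simp: periodic_def)
      have "\<not> ((\<exists>k::int. k > 0 \<and> P = of_int k * T) \<and> (\<exists>k::int. k > 0 \<and> \<alpha> * P = of_int k * T))"
      proof
        assume "(\<exists>k::int. k > 0 \<and> P = of_int k * T) \<and> (\<exists>k::int. k > 0 \<and> \<alpha> * P = of_int k * T)"
        then obtain k l :: int where kl: "k > 0" "P = of_int k * T" "\<alpha> * P = of_int l * T" by blast
        then have "(\<alpha> * of_int k) * T = of_int l * T" by simp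
        then have "\<alpha> * of_int k = of_int l" using T by simp
        then have "\<alpha> = of_int l / of_int k" using kl(1) by (simp add: field_simps)
        then show False using \<open>\<alpha> \<notin> \<rat>\<close> by simp
      qed
      then have "(\<forall>y. switched_solution A0 A1 u y \<longrightarrow> converges_exponentially_to_0 y) \<or>
              (\<forall>y. switched_solution A0 A1 v y \<longrightarrow> converges_exponentially_to_0 y)"
        using admissible_d_dichotomy[OF d T uv(1)] admissible_d_dichotomy[OF d T uv(2)] per[OF P] by blast
      then show "converges_exponentially_to_0 x"
        by (rule kron_sum_converges[OF C(1) _ uv \<open>\<alpha> > 0\<close> x', rotated]) (rule C(2))
    qed
  qed
  obtain B x where B: "piecewise_constant B"
      "\<And>t. B t \<in> {kron_sum \<alpha> A0 A0, kron_sum \<alpha> A1 A0, kron_sum \<alpha> A0 A1, kron_sum \<alpha> A1 A1}"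
      "caratheodory_solution B x" "\<not> accumulates_at_0 x"
    by (rule square_wave_switching_not_accumulating[OF c T \<open>\<alpha> > 0\<close>]) (rule that)
  have "\<forall>t\<ge>0. B t \<in> {B0, B1, B2, B3}" unfolding Bs using B(2) by blast
  moreover have "4 * (C * C) > 0" using C(1) by simp
  ultimately show ?thesis using main B by blast
qed

end
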